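(* Fix $k\in\mathbb N_0^2\setminus\{0\}$ and a nonzero $\xi_k=a_ke_k+\overline{a_k}e_{-k}+(-1)^{k_2+1}\overline{a_k}e_{\bar k}+(-1)^{k_2+1}a_ke_{-\bar k}$, and let $\kappa=\arctan(k_2/k_1)\in[0,\pi/2]$. Let $(l_m)_{m}$ be a sequence in $\mathbb N_0^2$ with $(l_m)_1\neq k_1$, $(l_m)_2\neq k_2$, $\|l_m\|\to\infty$ and $l_m/\|l_m\|\to l$, and put $\lambda=\arctan(l_2/l_1)\in[0,\pi/2]$. Let $\eta_{l_m}=b_me_{l_m}+\overline{b_m}e_{-l_m}+(-1)^{(l_m)_2+1}\overline{b_m}e_{\bar l_m}+(-1)^{(l_m)_2+1}b_me_{-\bar l_m}$ be nonzero ($b_m\in\mathbb C$). Then $$\lim_{m\to\infty}C(\xi_k,\eta_{l_m})=-\frac{\|k\|^2}{2S_{\mathbb T}}\big(\sin^4(\lambda-\kappa)+\sin^4(\lambda+\kappa)\big).$$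
   Context: $\mathbb T=\mathbb R^2/(2\pi\mathbb Z)^2$, area $S_{\mathbb T}=4\pi^2$, $I(x_1,x_2)=(2\pi-x_1,\pi+x_2)$, $\mathbb K=\mathbb T/I$; $C$ is the sectional curvature of $\mathrm{SDiff}(\mathbb K)$, whose Lie algebra is identified with real smooth zero-mean $f$ on $\mathbb T$ with $f\circ I=-f$, with bracket $\{f,g\}=\partial_{x_2}f\partial_{x_1}g-\partial_{x_1}f\partial_{x_2}g$, inner product $\langle f,g\rangle=\int_{\mathbb T}\nabla f\cdot\nabla g$, and $C(u,v)=\langle R(u,v)u,v\rangle/(\langle u,u\rangle\langle v,v\rangle-\langle u,v\rangle^2)$ where $R(u,v)w=-\nabla_u\nabla_vw+\nabla_v\nabla_uw+\nabla_{\{u,v\}}w$, $\nabla_uv=\frac12(\{u,v\}-B(u,v)-B(v,u))$, $\langle B(u,v),w\rangle=\langle u,\{v,w\}\rangle$. $e_k=e^{i(k_1x_1+k_2x_2)}$, $\bar k=(k_1,-k_2)$, $\|k\|^2=k_1^2+k_2^2$; $\arctan(x/0)=\pi/2$ for $x>0$. *)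

theory Defs
  imports "HOL-Analysis.Analysis"
begin

text \<open>Functions on the torus are represented as doubly 2pi-periodic functions on the plane.\<close>

type_synonym fn2 = "real \<times> real \<Rightarrow> real"

definition d1 :: "fn2 \<Rightarrow> fn2" where
  "d1 f x = deriv (\<lambda>t. f (t, snd x)) (fst x)"

definition d2 :: "fn2 \<Rightarrow> fn2" where
  "d2 f x = deriv (\<lambda>t. f (fst x, t)) (snd x)"

coinductive smooth2 :: "fn2 \<Rightarrow> bool" where
  "\<lbrakk> continuous_on UNIV f;
     \<forall>x. (\<lambda>t. f (t, snd x)) differentiable (at (fst x));
     \<forall>x. (\<lambda>t. f (fst x, t)) differentiable (at (snd x));
     smooth2 (d1 f); smooth2 (d2 f) \<rbrakk> \<Longrightarrow> smooth2 f"

definition torus_box :: "(real \<times> real) set" where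
  "torus_box = cbox (0, 0) (2 * pi, 2 * pi)"

definition S_T :: real where "S_T = 4 * pi^2"

definition Iinv :: "real \<times> real \<Rightarrow> real \<times> real" where
  "Iinv x = (2 * pi - fst x, pi + snd x)"

text \<open>Lie algebra of SDiff(K): smooth zero-mean functions on T, odd under I.\<close>
definition lie_alg :: "fn2 set" where
  "lie_alg = {f. smooth2 f
      \<and> (\<forall>x1 x2. f (x1 + 2 * pi, x2) = f (x1, x2) \<and> f (x1, x2 + 2 * pi) = f (x1, x2))
      \<and> integral torus_box f = 0
      \<and> (\<forall>x. f (Iinv x) = - f x)}"

definition pbr :: "fn2 \<Rightarrow> fn2 \<Rightarrow> fn2" where
  "pbr f g = (\<lambda>x. d2 f x * d1 g x - d1 f x * d2 g x)"

definition ip :: "fn2 \<Rightarrow> fn2 \<Rightarrow> real" where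
  "ip f g = integral torus_box (\<lambda>x. d1 f x * d1 g x + d2 f x * d2 g x)"

definition Bop :: "fn2 \<Rightarrow> fn2 \<Rightarrow> fn2" where
  "Bop u v = (THE w. w \<in> lie_alg \<and> (\<forall>h\<in>lie_alg. ip w h = ip u (pbr v h)))"

definition conn :: "fn2 \<Rightarrow> fn2 \<Rightarrow> fn2" where
  "conn u v = (\<lambda>x. (1/2) * (pbr u v x - Bop u v x - Bop v u x))"

definition Rcurv :: "fn2 \<Rightarrow> fn2 \<Rightarrow> fn2 \<Rightarrow> fn2" where
  "Rcurv u v w = (\<lambda>x. - conn u (conn v w) x + conn v (conn u w) x + conn (pbr u v) w x)"

definition sec_curv :: "fn2 \<Rightarrow> fn2 \<Rightarrow> real" where
  "sec_curv u v = ip (Rcurv u v u) v / (ip u u * ip v v - (ip u v)^2)"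

definition ek :: "int \<times> int \<Rightarrow> real \<times> real \<Rightarrow> complex" where
  "ek k x = cis (of_int (fst k) * fst x + of_int (snd k) * snd x)"

text \<open>xi a k = a e_k + conj a e_{-k} + (-1)^(k2+1) conj a e_{kbar} + (-1)^(k2+1) a e_{-kbar}
  (a real-valued function; we take Re of the complex expression, which is real).\<close>
definition xi :: "complex \<Rightarrow> nat \<times> nat \<Rightarrow> fn2" where
  "xi a k = (\<lambda>x. let k1 = int (fst k); k2 = int (snd k); s = (-1::complex) ^ (snd k + 1) in
     Re (a * ek (k1, k2) x + cnj a * ek (-k1, -k2) x
         + s * cnj a * ek (k1, -k2) x + s * a * ek (-k1, k2) x))"

definition ang :: "real \<Rightarrow> real \<Rightarrow> real" where
  "ang x y = (if x = 0 then pi / 2 else arctan (y / x))"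

end

theory Submission
  imports Defs
begin

text \<open>
  In terms of stream functions \<open>B(u, v) = \<Delta>\<^sup>-\<^sup>1 {\<Delta> u, v}\<close>, so on exponentials
  \<open>\<nabla>\<close> multiplies \<open>e\<^sub>p, e\<^sub>q\<close> into a multiple of \<open>e\<^sub>p\<^sub>+\<^sub>q\<close>. Because \<open>l\<close> differs from \<open>k\<close> in
  both components, only the frequency quadruples \<open>(p, q, -p, -q)\<close> contribute to
  \<open>\<langle>R(\<xi>, \<eta>)\<xi>, \<eta>\<rangle>\<close>, each with the weight \<open>-(p \<times> q)\<^sup>4 / |p - q|\<^sup>2\<close> of Arnold's formula for the flat
  torus. Thus \<open>C(\<xi>, \<eta>)\<close> is the average of \<open>-(p \<times> q)\<^sup>4 / (S |k|\<^sup>2 |l|\<^sup>2 |p - q|\<^sup>2)\<close> over the sign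
  changes \<open>p\<close> of \<open>k\<close> and \<open>q\<close> of \<open>l\<close>, and the limit is taken term by term. Averaging over the
  \<^emph>\<open>set\<close> of frequencies also covers the cases where some of the sign changes coincide.
\<close>

section \<open>Smooth functions\<close>

text \<open>\<open>Bop\<close> is given by a definite description, so each value must be exhibited
  and shown unique. Uniqueness comes from definiteness of the inner product on
  \<open>lie_alg\<close>. Existence is established for trigonometric polynomials, where the
  Laplacian is inverted by dividing the coefficient at p by -|p|^2. This acts on complex
  coefficients, while Lie algebra elements are real and odd under I; both properties survive because
  |p|^2 is unchanged by p -> -p and by p1 -> -p1. Frequency 0 is harmless: a bracket reaches it only
  from p and -p, where the cross product vanishes.

  The other quadruples drop out coordinate by coordinate: in p + r = -(q + s) the two sides are 0 or
  plus or minus twice the absolute values of k and l, which differ. Within an orbit all coefficients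
  have the same modulus, so the amplitudes a and b cancel in the quotient. For large l each weight
  tends to |k|^2/S times the fourth power of the sine of the angle between p and q; the sixteen sign
  choices give only two values of it, from lambda - kappa and lambda + kappa, equally often.\<close>

definition has_d1 :: "fn2 \<Rightarrow> fn2 \<Rightarrow> bool" where
  "has_d1 f f' \<longleftrightarrow> (\<forall>x y. ((\<lambda>t. f (t, y)) has_real_derivative f' (x, y)) (at x))"

definition has_d2 :: "fn2 \<Rightarrow> fn2 \<Rightarrow> bool" where
  "has_d2 f f' \<longleftrightarrow> (\<forall>x y. ((\<lambda>t. f (x, t)) has_real_derivative f' (x, y)) (at y))"

text \<open>\<open>deriv\<close> is total, so differentiability is recorded separately by
  \<open>has_d1\<close>; an exhibited derivative then determines \<open>d1\<close>.\<close>

lemma d1_eqI: "has_d1 f f' \<Longrightarrow> d1 f = f'"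
  by (auto simp: has_d1_def d1_def fun_eq_iff intro!: DERIV_imp_deriv)

lemma d2_eqI: "has_d2 f f' \<Longrightarrow> d2 f = f'"
  by (auto simp: has_d2_def d2_def fun_eq_iff intro!: DERIV_imp_deriv)

lemma has_d1_iff: "has_d1 f (d1 f) \<longleftrightarrow> (\<forall>x. (\<lambda>t. f (t, snd x)) differentiable (at (fst x)))"
  by (simp add: has_d1_def d1_def DERIV_deriv_iff_real_differentiable)

lemma has_d2_iff: "has_d2 f (d2 f) \<longleftrightarrow> (\<forall>x. (\<lambda>t. f (fst x, t)) differentiable (at (snd x)))"
  by (simp add: has_d2_def d2_def DERIV_deriv_iff_real_differentiable)

lemma smooth2_iff:
  "smooth2 f \<longleftrightarrow> continuous_on UNIV f \<and> has_d1 f (d1 f) \<and> has_d2 f (d2 f)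
     \<and> smooth2 (d1 f) \<and> smooth2 (d2 f)"
  unfolding has_d1_iff has_d2_iff by (subst smooth2.simps) auto

text \<open>Plain coinduction speaks of \<open>d1 f\<close> and \<open>d2 f\<close>. Here the
  partial derivatives may be exhibited in any form, as they are identified afterwards.\<close>

lemma smooth2_coinduct_has:
  assumes "X f"
    and "\<And>f. X f \<Longrightarrow> continuous_on UNIV f \<and> (\<exists>f1 f2. has_d1 f f1 \<and> has_d2 f f2 \<and> X f1 \<and> X f2)"
  shows "smooth2 f"
  using assms(1)
proof (coinduction arbitrary: f rule: smooth2.coinduct)
  case (smooth2 f)
  then obtain f1 f2 where "continuous_on UNIV f" "has_d1 f f1" "has_d2 f f2" "X f1" "X f2"
    using assms(2) by blast
  moreover from this have "d1 f = f1" "d2 f = f2" by (auto intro: d1_eqI d2_eqI)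
  ultimately show ?case
    using has_d1_iff[of f] has_d2_iff[of f] by auto
qed

section \<open>Closure of smooth functions under sums and products\<close>

lemma has_d1_add: "has_d1 f f' \<Longrightarrow> has_d1 g g' \<Longrightarrow> has_d1 (\<lambda>x. f x + g x) (\<lambda>x. f' x + g' x)"
  by (auto simp: has_d1_def intro!: DERIV_add)

lemma has_d2_add: "has_d2 f f' \<Longrightarrow> has_d2 g g' \<Longrightarrow> has_d2 (\<lambda>x. f x + g x) (\<lambda>x. f' x + g' x)"
  by (auto simp: has_d2_def intro!: DERIV_add)

lemma has_d1_mult:
  "has_d1 f f' \<Longrightarrow> has_d1 g g' \<Longrightarrow> has_d1 (\<lambda>x. f x * g x) (\<lambda>x. f' x * g x + f x * g' x)"
  by (auto simp: has_d1_def intro!: derivative_eq_intros)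

lemma has_d2_mult:
  "has_d2 f f' \<Longrightarrow> has_d2 g g' \<Longrightarrow> has_d2 (\<lambda>x. f x * g x) (\<lambda>x. f' x * g x + f x * g' x)"
  by (auto simp: has_d2_def intro!: derivative_eq_intros)

text \<open>A coinduction invariant: by the Leibniz rule products alone are not stable under
  differentiation, but the algebra generated by the smooth functions is.\<close>

inductive smooth_closure :: "fn2 \<Rightarrow> bool" where
  base: "smooth2 f \<Longrightarrow> smooth_closure f"
| const: "smooth_closure (\<lambda>x. c)"
| add: "smooth_closure f \<Longrightarrow> smooth_closure g \<Longrightarrow> smooth_closure (\<lambda>x. f x + g x)"
| mult: "smooth_closure f \<Longrightarrow> smooth_closure g \<Longrightarrow> smooth_closure (\<lambda>x. f x * g x)"

lemma smooth_closure_step: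
  "smooth_closure f \<Longrightarrow> continuous_on UNIV f \<and>
     (\<exists>f1 f2. has_d1 f f1 \<and> has_d2 f f2 \<and> smooth_closure f1 \<and> smooth_closure f2)"
proof (induction rule: smooth_closure.induct)
  case (base f)
  then show ?case using smooth2_iff[of f] by (metis smooth_closure.base)
next
  case (const c)
  have "has_d1 (\<lambda>x. c) (\<lambda>x. 0)" "has_d2 (\<lambda>x. c) (\<lambda>x. 0)"
    by (auto simp: has_d1_def has_d2_def)
  then show ?case using smooth_closure.const[of 0] by auto
next
  case (add f g)
  then obtain f1 f2 g1 g2 where "has_d1 f f1" "has_d2 f f2" "has_d1 g g1" "has_d2 g g2"
    "smooth_closure f1" "smooth_closure f2" "smooth_closure g1" "smooth_closure g2" by blast
  then show ?case using add
    by (blast intro: has_d1_add has_d2_add continuous_on_add smooth_closure.add)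
next
  case (mult f g)
  then obtain f1 f2 g1 g2 where "has_d1 f f1" "has_d2 f f2" "has_d1 g g1" "has_d2 g g2"
    "smooth_closure f1" "smooth_closure f2" "smooth_closure g1" "smooth_closure g2" by blast
  then have "smooth_closure (\<lambda>x. f1 x * g x + f x * g1 x)" "smooth_closure (\<lambda>x. f2 x * g x + f x * g2 x)"
    "has_d1 (\<lambda>x. f x * g x) (\<lambda>x. f1 x * g x + f x * g1 x)"
    "has_d2 (\<lambda>x. f x * g x) (\<lambda>x. f2 x * g x + f x * g2 x)"
    using mult.hyps by (auto intro: has_d1_mult has_d2_mult smooth_closure.add smooth_closure.mult)
  then show ?case using mult.IH by (blast intro: continuous_on_mult)
qed

lemma smooth_closure_smooth2: "smooth_closure f \<Longrightarrow> smooth2 f"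
  by (erule smooth2_coinduct_has[of smooth_closure]) (rule smooth_closure_step)

lemma smooth2_const: "smooth2 (\<lambda>x. c)"
  by (intro smooth_closure_smooth2 smooth_closure.const)

lemma smooth2_add: "smooth2 f \<Longrightarrow> smooth2 g \<Longrightarrow> smooth2 (\<lambda>x. f x + g x)"
  by (rule smooth_closure_smooth2) (intro smooth_closure.add smooth_closure.base)

lemma smooth2_mult: "smooth2 f \<Longrightarrow> smooth2 g \<Longrightarrow> smooth2 (\<lambda>x. f x * g x)"
  by (rule smooth_closure_smooth2) (intro smooth_closure.mult smooth_closure.base)

lemma smooth2_cmult: "smooth2 f \<Longrightarrow> smooth2 (\<lambda>x. c * f x)"
  by (intro smooth2_mult smooth2_const)

lemma smooth2_diff: "smooth2 f \<Longrightarrow> smooth2 g \<Longrightarrow> smooth2 (\<lambda>x. f x - g x)"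
  using smooth2_add[of f "\<lambda>x. -1 * g x"] smooth2_cmult[of g "-1"] by simp

lemma smooth2_continuous: "smooth2 f \<Longrightarrow> continuous_on A f"
  using smooth2_iff[of f] continuous_on_subset by blast

lemma smooth2_d1: "smooth2 f \<Longrightarrow> smooth2 (d1 f)"
  and smooth2_d2: "smooth2 f \<Longrightarrow> smooth2 (d2 f)"
  and smooth2_has_d1: "smooth2 f \<Longrightarrow> has_d1 f (d1 f)"
  and smooth2_has_d2: "smooth2 f \<Longrightarrow> has_d2 f (d2 f)"
  using smooth2_iff[of f] by auto

lemmas smooth2_intros = smooth2_const smooth2_add smooth2_mult smooth2_diff smooth2_d1 smooth2_d2

lemma smooth2_pbr: "smooth2 f \<Longrightarrow> smooth2 g \<Longrightarrow> smooth2 (pbr f g)"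
  unfolding pbr_def by (intro smooth2_intros)

lemma
  assumes "smooth2 f" "smooth2 g"
  shows d1_add: "d1 (\<lambda>x. f x + g x) = (\<lambda>x. d1 f x + d1 g x)"
    and d2_add: "d2 (\<lambda>x. f x + g x) = (\<lambda>x. d2 f x + d2 g x)"
    and d1_mult: "d1 (\<lambda>x. f x * g x) = (\<lambda>x. d1 f x * g x + f x * d1 g x)"
    and d2_mult: "d2 (\<lambda>x. f x * g x) = (\<lambda>x. d2 f x * g x + f x * d2 g x)"
  using assms
  by (auto intro!: d1_eqI d2_eqI has_d1_add has_d2_add has_d1_mult has_d2_mult
      smooth2_has_d1 smooth2_has_d2)

lemma
  assumes "smooth2 f"
  shows d1_cmult: "d1 (\<lambda>x. c * f x) = (\<lambda>x. c * d1 f x)"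
    and d2_cmult: "d2 (\<lambda>x. c * f x) = (\<lambda>x. c * d2 f x)"
proof -
  have "d1 (\<lambda>x. c) = (\<lambda>x. 0)" "d2 (\<lambda>x. c) = (\<lambda>x. 0)"
    by (auto intro!: d1_eqI d2_eqI simp: has_d1_def has_d2_def)
  then show "d1 (\<lambda>x. c * f x) = (\<lambda>x. c * d1 f x)" "d2 (\<lambda>x. c * f x) = (\<lambda>x. c * d2 f x)"
    using d1_mult[OF smooth2_const[of c] assms] d2_mult[OF smooth2_const[of c] assms] by auto
qed

section \<open>Integration over the torus\<close>

definition periodic2 :: "fn2 \<Rightarrow> bool" where
  "periodic2 f \<longleftrightarrow>
     (\<forall>x1 x2. f (x1 + 2 * pi, x2) = f (x1, x2) \<and> f (x1, x2 + 2 * pi) = f (x1, x2))"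

lemma periodic2_d1:
  assumes "smooth2 f" "periodic2 f" shows "periodic2 (d1 f)"
  unfolding periodic2_def
proof (intro allI conjI)
  fix x y
  have D: "((\<lambda>t. f (t, y)) has_real_derivative d1 f (x, y)) (at x)" for x y
    using smooth2_has_d1[OF assms(1)] by (simp add: has_d1_def)
  have "((\<lambda>t. f (t + 2 * pi, y)) has_real_derivative d1 f (x + 2 * pi, y)) (at x)"
    using D[of y "x + 2 * pi"] by (simp add: DERIV_shift)
  then show "d1 f (x + 2 * pi, y) = d1 f (x, y)"
    using D[of y x] assms(2) by (auto simp: periodic2_def intro: DERIV_unique)
  show "d1 f (x, y + 2 * pi) = d1 f (x, y)"
    using assms(2) by (simp add: periodic2_def d1_def)
qed

lemma periodic2_d2:
  assumes "smooth2 f" "periodic2 f" shows "periodic2 (d2 f)"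
  unfolding periodic2_def
proof (intro allI conjI)
  fix x y
  have D: "((\<lambda>t. f (x, t)) has_real_derivative d2 f (x, y)) (at y)" for x y
    using smooth2_has_d2[OF assms(1)] by (simp add: has_d2_def)
  have "((\<lambda>t. f (x, t + 2 * pi)) has_real_derivative d2 f (x, y + 2 * pi)) (at y)"
    using D[of x "y + 2 * pi"] by (simp add: DERIV_shift)
  then show "d2 f (x, y + 2 * pi) = d2 f (x, y)"
    using D[of x y] assms(2) by (auto simp: periodic2_def intro: DERIV_unique)
  show "d2 f (x + 2 * pi, y) = d2 f (x, y)"
    using assms(2) by (simp add: periodic2_def d2_def)
qed

lemma periodic2_mult: "periodic2 f \<Longrightarrow> periodic2 g \<Longrightarrow> periodic2 (\<lambda>x. f x * g x)"
  by (simp add: periodic2_def)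

lemma periodic2_diff: "periodic2 f \<Longrightarrow> periodic2 g \<Longrightarrow> periodic2 (\<lambda>x. f x - g x)"
  by (simp add: periodic2_def)

lemma periodic2_add: "periodic2 f \<Longrightarrow> periodic2 g \<Longrightarrow> periodic2 (\<lambda>x. f x + g x)"
  by (simp add: periodic2_def)

lemma periodic2_pbr:
  "smooth2 f \<Longrightarrow> smooth2 g \<Longrightarrow> periodic2 f \<Longrightarrow> periodic2 g \<Longrightarrow> periodic2 (pbr f g)"
  unfolding pbr_def by (intro periodic2_mult periodic2_diff periodic2_d1 periodic2_d2)

lemma smooth2_integrable: "smooth2 f \<Longrightarrow> f integrable_on torus_box"
  unfolding torus_box_def by (intro integrable_continuous smooth2_continuous)

lemma integral_d2_eq_0:
  assumes f: "smooth2 f" and p: "periodic2 f"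
  shows "integral torus_box (d2 f) = 0"
proof -
  have "integral torus_box (d2 f) =
    integral (cbox 0 (2*pi)) (\<lambda>x. integral (cbox 0 (2*pi)) (\<lambda>y. d2 f (x, y)))"
    unfolding torus_box_def by (intro integral_prod_continuous smooth2_continuous smooth2_d2 f)
  also have "\<dots> = integral (cbox 0 (2*pi)) (\<lambda>x. 0)"
  proof (rule integral_cong)
    fix x
    have "((\<lambda>y. d2 f (x, y)) has_integral (f (x, 2*pi) - f (x, 0))) {0..2*pi}"
      using smooth2_has_d2[OF f]
      by (intro fundamental_theorem_of_calculus)
        (auto simp: has_d2_def has_real_derivative_iff_has_vector_derivative
          intro: has_vector_derivative_at_within)
    moreover have "f (x, 2*pi) = f (x, 0)" using p[unfolded periodic2_def, rule_format, of x 0] by simp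
    ultimately show "integral (cbox 0 (2*pi)) (\<lambda>y. d2 f (x, y)) = 0"
      by (simp add: integral_unique)
  qed
  finally show ?thesis by simp
qed

lemma integral_d1_eq_0:
  assumes f: "smooth2 f" and p: "periodic2 f"
  shows "integral torus_box (d1 f) = 0"
proof -
  have c: "continuous_on (cbox (0,0) (2*pi,2*pi)) (d1 f)"
    by (intro smooth2_continuous smooth2_d1 f)
  have "integral torus_box (d1 f) =
    integral (cbox 0 (2*pi)) (\<lambda>x. integral (cbox 0 (2*pi)) (\<lambda>y. d1 f (x, y)))"
    unfolding torus_box_def by (intro integral_prod_continuous c)
  \<comment> \<open>The iterated integral has x2 innermost; the order is exchanged so that the
    fundamental theorem applies along x1.\<close>
  also have "\<dots> = integral (cbox 0 (2*pi)) (\<lambda>y. integral (cbox 0 (2*pi)) (\<lambda>x. d1 f (x, y)))"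
    by (rule integral_swap_continuous) (use c in \<open>simp add: case_prod_unfold\<close>)
  also have "\<dots> = integral (cbox 0 (2*pi)) (\<lambda>x. 0)"
  proof (rule integral_cong)
    fix y
    have "((\<lambda>x. d1 f (x, y)) has_integral (f (2*pi, y) - f (0, y))) {0..2*pi}"
      using smooth2_has_d1[OF f]
      by (intro fundamental_theorem_of_calculus)
        (auto simp: has_d1_def has_real_derivative_iff_has_vector_derivative
          intro: has_vector_derivative_at_within)
    moreover have "f (2*pi, y) = f (0, y)" using p[unfolded periodic2_def, rule_format, of 0 y] by simp
    ultimately show "integral (cbox 0 (2*pi)) (\<lambda>x. d1 f (x, y)) = 0"
      by (simp add: integral_unique)
  qed
  finally show ?thesis by simp
qed

section \<open>Integration by parts for the Laplacian and the bracket\<close>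

lemma integral_by_parts_d1:
  assumes "smooth2 f" "smooth2 g" "periodic2 f" "periodic2 g"
  shows "integral torus_box (\<lambda>x. f x * d1 g x) = - integral torus_box (\<lambda>x. d1 f x * g x)"
proof -
  have "0 = integral torus_box (\<lambda>x. d1 f x * g x + f x * d1 g x)"
    using integral_d1_eq_0[of "\<lambda>x. f x * g x"] assms
    by (simp add: smooth2_mult periodic2_mult d1_mult)
  also have "\<dots> = integral torus_box (\<lambda>x. d1 f x * g x) + integral torus_box (\<lambda>x. f x * d1 g x)"
    by (intro integral_add smooth2_integrable smooth2_intros assms)
  finally show ?thesis by simp
qed

lemma integral_by_parts_d2:
  assumes "smooth2 f" "smooth2 g" "periodic2 f" "periodic2 g"
  shows "integral torus_box (\<lambda>x. f x * d2 g x) = - integral torus_box (\<lambda>x. d2 f x * g x)"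
proof -
  have "0 = integral torus_box (\<lambda>x. d2 f x * g x + f x * d2 g x)"
    using integral_d2_eq_0[of "\<lambda>x. f x * g x"] assms
    by (simp add: smooth2_mult periodic2_mult d2_mult)
  also have "\<dots> = integral torus_box (\<lambda>x. d2 f x * g x) + integral torus_box (\<lambda>x. f x * d2 g x)"
    by (intro integral_add smooth2_integrable smooth2_intros assms)
  finally show ?thesis by simp
qed

definition lap :: "fn2 \<Rightarrow> fn2" where
  "lap f = (\<lambda>x. d1 (d1 f) x + d2 (d2 f) x)"

lemma smooth2_lap: "smooth2 f \<Longrightarrow> smooth2 (lap f)"
  unfolding lap_def by (intro smooth2_intros)

lemma periodic2_lap: "smooth2 f \<Longrightarrow> periodic2 f \<Longrightarrow> periodic2 (lap f)"
  unfolding lap_def by (intro periodic2_add periodic2_d1 periodic2_d2 smooth2_intros)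

lemma ip_eq_lap:
  assumes "smooth2 f" "smooth2 g" "periodic2 f" "periodic2 g"
  shows "ip f g = - integral torus_box (\<lambda>x. lap f x * g x)"
proof -
  note i = smooth2_integrable smooth2_intros periodic2_d1 periodic2_d2 assms
  have "ip f g = integral torus_box (\<lambda>x. d1 f x * d1 g x) + integral torus_box (\<lambda>x. d2 f x * d2 g x)"
    unfolding ip_def by (intro integral_add i)
  also have "\<dots> = - (integral torus_box (\<lambda>x. d1 (d1 f) x * g x) + integral torus_box (\<lambda>x. d2 (d2 f) x * g x))"
    using integral_by_parts_d1[of "d1 f" g] integral_by_parts_d2[of "d2 f" g] by (simp add: i)
  also have "integral torus_box (\<lambda>x. d1 (d1 f) x * g x) + integral torus_box (\<lambda>x. d2 (d2 f) x * g x)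
     = integral torus_box (\<lambda>x. lap f x * g x)"
    unfolding lap_def distrib_right by (rule sym, intro integral_add i)
  finally show ?thesis .
qed

text \<open>Moving the derivatives off h leaves {f, g} h plus f h (d2 d1 g - d1 d2 g). The
  hypothesis \<open>mixed\<close> removes the second term; it is discharged by
  \<open>trep_mixed\<close> wherever brackets are integrated.\<close>

lemma integral_pbr_cyclic:
  assumes s: "smooth2 f" "smooth2 g" "smooth2 h" and p: "periodic2 f" "periodic2 g" "periodic2 h"
    and mixed: "d1 (d2 g) = d2 (d1 g)"
  shows "integral torus_box (\<lambda>x. f x * pbr g h x) = integral torus_box (\<lambda>x. pbr f g x * h x)"
proof -
  note i = smooth2_integrable smooth2_intros periodic2_d1 periodic2_d2 periodic2_mult s p
  have "integral torus_box (\<lambda>x. f x * pbr g h x)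
      = integral torus_box (\<lambda>x. (f x * d2 g x) * d1 h x - (f x * d1 g x) * d2 h x)"
    by (simp add: pbr_def algebra_simps)
  also have "\<dots> = integral torus_box (\<lambda>x. (f x * d2 g x) * d1 h x)
      - integral torus_box (\<lambda>x. (f x * d1 g x) * d2 h x)"
    by (intro integral_diff i)
  also have "\<dots> = integral torus_box (\<lambda>x. d2 (\<lambda>x. f x * d1 g x) x * h x)
      - integral torus_box (\<lambda>x. d1 (\<lambda>x. f x * d2 g x) x * h x)"
    using integral_by_parts_d1[of "\<lambda>x. f x * d2 g x" h] integral_by_parts_d2[of "\<lambda>x. f x * d1 g x" h]
    by (simp add: i)
  also have "\<dots> = integral torus_box (\<lambda>x. d2 (\<lambda>x. f x * d1 g x) x * h x
      - d1 (\<lambda>x. f x * d2 g x) x * h x)"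
    by (rule sym, intro integral_diff i)
  also have "\<dots> = integral torus_box (\<lambda>x. pbr f g x * h x)"
    by (simp add: d1_mult d2_mult i mixed pbr_def algebra_simps)
  finally show ?thesis .
qed

section \<open>The Lie algebra\<close>

lemma lie_alg_iff:
  "f \<in> lie_alg \<longleftrightarrow> smooth2 f \<and> periodic2 f \<and> integral torus_box f = 0 \<and> (\<forall>x. f (Iinv x) = - f x)"
  by (simp add: lie_alg_def periodic2_def)

lemma lie_alg_odd: "f \<in> lie_alg \<Longrightarrow> f (Iinv x) = - f x"
  unfolding lie_alg_iff by blast

lemma lie_alg_add: "f \<in> lie_alg \<Longrightarrow> g \<in> lie_alg \<Longrightarrow> (\<lambda>x. f x + g x) \<in> lie_alg"
  by (simp add: lie_alg_iff smooth2_add periodic2_add integral_add smooth2_integrable)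

lemma lie_alg_cmult: "f \<in> lie_alg \<Longrightarrow> (\<lambda>x. c * f x) \<in> lie_alg"
  by (simp add: lie_alg_iff smooth2_cmult periodic2_def)

lemma lie_alg_diff: "f \<in> lie_alg \<Longrightarrow> g \<in> lie_alg \<Longrightarrow> (\<lambda>x. f x - g x) \<in> lie_alg"
  using lie_alg_add[of f "\<lambda>x. -1 * g x"] lie_alg_cmult[of g "-1"] by simp

text \<open>The reflection x1 -> 2 pi - x1 contributes the sign. A general \<sigma> is carried
  because \<open>d1\<close> turns odd functions into even ones, so second derivatives need both
  parities.\<close>

lemma d1_Iinv:
  assumes f: "smooth2 f" and I: "\<And>x. f (Iinv x) = \<sigma> * f x"
  shows "d1 f (Iinv x) = - \<sigma> * d1 f x"
proof -
  obtain a b where x: "x = (a, b)" by (cases x)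
  have D: "((\<lambda>t. f (t, y)) has_real_derivative d1 f (x, y)) (at x)" for x y
    using smooth2_has_d1[OF f] by (simp add: has_d1_def)
  have "((\<lambda>t. f (2*pi - t, pi + b)) has_real_derivative - d1 f (2*pi - a, pi + b)) (at a)"
    by (rule DERIV_chain2[where g = "\<lambda>t. 2*pi - t" and Db = "- 1", OF D[of "pi + b" "2*pi - a"],
          THEN DERIV_cong])
      (auto intro!: derivative_eq_intros)
  moreover have "(\<lambda>t. f (2*pi - t, pi + b)) = (\<lambda>t. \<sigma> * f (t, b))"
    using I[of "(_, b)"] by (auto simp: Iinv_def fun_eq_iff)
  ultimately have "- d1 f (2*pi - a, pi + b) = \<sigma> * d1 f (a, b)"
    using DERIV_cmult[OF D[of b a], of \<sigma>] by (auto intro: DERIV_unique)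
  then show ?thesis by (simp add: x Iinv_def)
qed

lemma d2_Iinv:
  assumes f: "smooth2 f" and I: "\<And>x. f (Iinv x) = \<sigma> * f x"
  shows "d2 f (Iinv x) = \<sigma> * d2 f x"
proof -
  obtain a b where x: "x = (a, b)" by (cases x)
  have D: "((\<lambda>t. f (x, t)) has_real_derivative d2 f (x, y)) (at y)" for x y
    using smooth2_has_d2[OF f] by (simp add: has_d2_def)
  have "((\<lambda>t. f (2*pi - a, pi + t)) has_real_derivative d2 f (2*pi - a, pi + b)) (at b)"
    by (rule DERIV_chain2[where g = "\<lambda>t. pi + t" and Db = 1, OF D[of "2*pi - a" "pi + b"],
          THEN DERIV_cong])
      (auto intro!: derivative_eq_intros)
  moreover have "(\<lambda>t. f (2*pi - a, pi + t)) = (\<lambda>t. \<sigma> * f (a, t))"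
    using I[of "(a, _)"] by (auto simp: Iinv_def fun_eq_iff)
  ultimately have "d2 f (2*pi - a, pi + b) = \<sigma> * d2 f (a, b)"
    using DERIV_cmult[OF D[of a b], of \<sigma>] by (auto intro: DERIV_unique)
  then show ?thesis by (simp add: x Iinv_def)
qed

text \<open>Each term of the bracket contains exactly one derivative in x1, hence one extra minus
  sign; two odd functions therefore have an odd bracket.\<close>

lemma pbr_Iinv:
  assumes "smooth2 f" "smooth2 g"
    and "\<And>x. f (Iinv x) = \<sigma> * f x" "\<And>x. g (Iinv x) = \<tau> * g x"
  shows "pbr f g (Iinv x) = - (\<sigma> * \<tau>) * pbr f g x"
  using d1_Iinv[OF assms(1,3)] d2_Iinv[OF assms(1,3)] d1_Iinv[OF assms(2,4)] d2_Iinv[OF assms(2,4)]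
  by (simp add: pbr_def algebra_simps)

lemma lap_Iinv:
  assumes f: "smooth2 f" and I: "\<And>x. f (Iinv x) = \<sigma> * f x"
  shows "lap f (Iinv x) = \<sigma> * lap f x"
  using d1_Iinv[OF smooth2_d1[OF f] d1_Iinv[OF f I]] d2_Iinv[OF smooth2_d2[OF f] d2_Iinv[OF f I]]
  by (simp add: lap_def algebra_simps)

lemma lie_alg_pbr:
  assumes f: "f \<in> lie_alg" and g: "g \<in> lie_alg" and mixed: "d1 (d2 g) = d2 (d1 g)"
  shows "pbr f g \<in> lie_alg"
proof -
  have s: "smooth2 f" "smooth2 g" and p: "periodic2 f" "periodic2 g"
    using f g by (auto simp: lie_alg_iff)
  have o: "f (Iinv x) = (- 1) * f x" "g (Iinv x) = (- 1) * g x" for x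
    using f g by (simp_all add: lie_alg_odd)
  have "d1 (\<lambda>x. 1) = (\<lambda>x. 0)" "d2 (\<lambda>x. 1) = (\<lambda>x. 0)"
    by (auto intro!: d1_eqI d2_eqI simp: has_d1_def has_d2_def)
  then have "pbr (\<lambda>x. 1) g = (\<lambda>x. 0)" by (simp add: pbr_def)
  \<comment> \<open>The zero mean is the cyclic identity with the constant 1 in the first slot,
    whose brackets vanish. With g in the middle slot, the mixed partials of g are the ones that must
    commute.\<close>
  moreover have "integral torus_box (\<lambda>x. 1 * pbr g f x) = integral torus_box (\<lambda>x. pbr (\<lambda>x. 1) g x * f x)"
    by (intro integral_pbr_cyclic s p smooth2_const mixed) (simp add: periodic2_def)
  moreover have "pbr g f = (\<lambda>x. - pbr f g x)" by (simp add: pbr_def fun_eq_iff)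
  ultimately have "integral torus_box (pbr f g) = 0" by simp
  moreover have "pbr f g (Iinv x) = - pbr f g x" for x
    using pbr_Iinv[OF s o] by simp
  ultimately show ?thesis
    using s p by (simp add: lie_alg_iff smooth2_pbr periodic2_pbr)
qed

section \<open>Definiteness of the inner product and the operator B\<close>

lemma
  assumes "smooth2 f" "smooth2 g" "smooth2 h"
  shows ip_add_left: "ip (\<lambda>x. f x + g x) h = ip f h + ip g h"
    and ip_diff_left: "ip (\<lambda>x. f x - g x) h = ip f h - ip g h"
proof -
  note i = smooth2_integrable smooth2_intros assms
  have add: "ip (\<lambda>x. f x + g x) h = ip f h + ip g h" if "smooth2 f" "smooth2 g" for f g
    unfolding ip_def d1_add[OF that] d2_add[OF that] distrib_right
    by (subst integral_add[symmetric]; (intro i that)?) (simp add: algebra_simps)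
  have cmult: "ip (\<lambda>x. c * f x) h = c * ip f h" if "smooth2 f" for f c
    unfolding ip_def d1_cmult[OF that] d2_cmult[OF that]
    by (subst integral_mult_right[symmetric]) (simp add: algebra_simps)
  show "ip (\<lambda>x. f x + g x) h = ip f h + ip g h" using add assms by blast
  show "ip (\<lambda>x. f x - g x) h = ip f h - ip g h"
    using add[of f "\<lambda>x. -1 * g x"] cmult[of g "-1"] assms smooth2_cmult[of g "-1"] by simp
qed

text \<open>A continuous nonnegative integrand with integral 0 vanishes, so z is constant on the
  box, hence everywhere by periodicity; the zero mean makes the constant 0.\<close>

lemma ip_self_eq_0D:
  assumes z: "z \<in> lie_alg" and ip: "ip z z = 0"
  shows "z = (\<lambda>x. 0)"
proof -
  have s: "smooth2 z" and p: "periodic2 z" and mean: "integral torus_box z = 0"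
    using z by (auto simp: lie_alg_iff)
  have ne: "box (0::real,0::real) (2*pi,2*pi) \<noteq> {}"
    by (auto simp: box_ne_empty Basis_prod_def)
  have "\<forall>x\<in>cbox (0,0) (2*pi,2*pi). d1 z x * d1 z x + d2 z x * d2 z x = 0"
    using ip unfolding ip_def torus_box_def
    by (subst (asm) integral_cbox_eq_0_iff) (use ne in \<open>auto intro!: smooth2_continuous smooth2_intros s\<close>)
  then have D0: "d1 z (x, y) = 0" "d2 z (x, y) = 0" if "x \<in> {0..2*pi}" "y \<in> {0..2*pi}" for x y
    using that by (auto simp: sum_squares_eq_zero_iff dest!: bspec[of _ _ "(x, y)"])
  have const: "z (x, y) = z (0, 0)" if "x \<in> {0..2*pi}" "y \<in> {0..2*pi}" for x y
  proof -
    have "z (x, y) = z (0, y)"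
    proof (cases "x = 0")
      case False
      with that have "0 < x" by simp
      then show ?thesis
      proof (rule DERIV_isconst_end[of 0 x "\<lambda>t. z (t, y)"])
        show "continuous_on {0..x} (\<lambda>t. z (t, y))"
          by (rule DERIV_continuous_on[where D = "\<lambda>t. d1 z (t, y)"], rule has_field_derivative_at_within)
            (use smooth2_has_d1[OF s] in \<open>simp add: has_d1_def\<close>)
        show "((\<lambda>t. z (t, y)) has_real_derivative 0) (at t)" if "0 < t" "t < x" for t
          using smooth2_has_d1[OF s, unfolded has_d1_def, rule_format, of y t] D0(1)[of t y] that
            \<open>x \<in> _\<close> \<open>y \<in> _\<close> by simp
      qed
    qed simp
    moreover have "z (0, y) = z (0, 0)"
    proof (cases "y = 0")
      case False
      with that have "0 < y" by simp
      then show ?thesis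
      proof (rule DERIV_isconst_end[of 0 y "\<lambda>t. z (0, t)"])
        show "continuous_on {0..y} (\<lambda>t. z (0, t))"
          by (rule DERIV_continuous_on[where D = "\<lambda>t. d2 z (0, t)"], rule has_field_derivative_at_within)
            (use smooth2_has_d2[OF s] in \<open>simp add: has_d2_def\<close>)
        show "((\<lambda>t. z (0, t)) has_real_derivative 0) (at t)" if "0 < t" "t < y" for t
          using smooth2_has_d2[OF s, unfolded has_d2_def, rule_format, of 0 t] D0(2)[of 0 t] that
            \<open>y \<in> _\<close> by simp
      qed
    qed simp
    ultimately show ?thesis by simp
  qed
  have "integral torus_box z = integral torus_box (\<lambda>x. z (0, 0))"
    by (rule integral_cong) (auto simp: torus_box_def intro!: const)
  also have "\<dots> = 4 * pi^2 * z (0, 0)"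
    by (simp add: torus_box_def content_Pair power2_eq_square)
  finally have z0: "z (0, 0) = 0" using mean by simp
  \<comment> \<open>Every real number is moved into the fundamental interval by subtracting whole
    periods, counted by the floor.\<close>
  have red: "\<exists>t'\<in>{0..2*pi}. \<exists>n::int. t = t' + of_int n * (2*pi)" for t :: real
  proof (intro bexI exI)
    let ?n = "\<lfloor>t / (2*pi)\<rfloor>"
    show "t = (t - of_int ?n * (2*pi)) + of_int ?n * (2*pi)" by simp
    have "of_int ?n \<le> t / (2*pi)" "t / (2*pi) \<le> of_int ?n + 1" by linarith+
    then have "of_int ?n * (2*pi) \<le> t" "t \<le> (of_int ?n + 1) * (2*pi)"
      by (metis le_divide_eq divide_le_eq pi_gt_zero zero_less_mult_iff zero_less_numeral)+
    then show "t - of_int ?n * (2*pi) \<in> {0..2*pi}" by (simp add: algebra_simps)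
  qed
  have "z (x, y) = 0" for x y
  proof -
    obtain x' m where x: "x' \<in> {0..2*pi}" "x = x' + of_int m * (2*pi)" using red by blast
    obtain y' n where y: "y' \<in> {0..2*pi}" "y = y' + of_int n * (2*pi)" using red by blast
    interpret p1: periodic_fun_simple "\<lambda>t. z (t, y)" "2*pi"
      by unfold_locales (use p in \<open>simp add: periodic2_def\<close>)
    interpret p2: periodic_fun_simple "\<lambda>t. z (x', t)" "2*pi"
      by unfold_locales (use p in \<open>simp add: periodic2_def\<close>)
    have "z (x, y) = z (x', y)" using p1.plus_of_int[of x' m] x by simp
    also have "\<dots> = z (x', y')" using p2.plus_of_int[of y' n] y by simp
    finally show ?thesis using const[OF x(1) y(1)] z0 by simp
  qed
  then show ?thesis by auto
qed

text \<open>For uniqueness, the difference of two candidates lies in \<open>lie_alg\<close> and can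
  serve as its own test function.\<close>

lemma Bop_eqI:
  assumes w: "w \<in> lie_alg" and char: "\<And>h. h \<in> lie_alg \<Longrightarrow> ip w h = ip u (pbr v h)"
  shows "Bop u v = w"
  unfolding Bop_def
proof (rule the_equality)
  show "w \<in> lie_alg \<and> (\<forall>h\<in>lie_alg. ip w h = ip u (pbr v h))" using assms by blast
next
  fix w' assume w': "w' \<in> lie_alg \<and> (\<forall>h\<in>lie_alg. ip w' h = ip u (pbr v h))"
  let ?z = "\<lambda>x. w' x - w x"
  have z: "?z \<in> lie_alg" using w w' by (simp add: lie_alg_diff)
  have "ip ?z ?z = ip w' ?z - ip w ?z"
    using w w' z by (intro ip_diff_left) (auto simp: lie_alg_iff)
  also have "\<dots> = 0" using w' char z by simp
  finally have "?z = (\<lambda>x. 0)" by (rule ip_self_eq_0D[OF z])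
  then show "w' = w" by (auto simp: fun_eq_iff)
qed

text \<open>Green's formula and the cyclic identity give <u, {v, h}> = -(integral of {lap u, v} h),
  which is <w, h> once lap w = {lap u, v}.\<close>

lemma Bop_eq_if_lap_eq:
  assumes w: "w \<in> lie_alg" and u: "u \<in> lie_alg" and v: "v \<in> lie_alg"
    and mixed: "d1 (d2 v) = d2 (d1 v)" and lap: "lap w = pbr (lap u) v"
  shows "Bop u v = w"
proof (rule Bop_eqI[OF w])
  fix h assume h: "h \<in> lie_alg"
  note s = w[unfolded lie_alg_iff] u[unfolded lie_alg_iff] v[unfolded lie_alg_iff] h[unfolded lie_alg_iff]
  have "ip u (pbr v h) = - integral torus_box (\<lambda>x. lap u x * pbr v h x)"
    using s by (intro ip_eq_lap) (auto intro: smooth2_pbr periodic2_pbr)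
  also have "\<dots> = - integral torus_box (\<lambda>x. pbr (lap u) v x * h x)"
    using s by (subst integral_pbr_cyclic) (auto intro: smooth2_lap periodic2_lap mixed)
  also have "\<dots> = ip w h"
    using s by (subst ip_eq_lap) (auto simp: lap)
  finally show "ip w h = ip u (pbr v h)" by simp
qed

section \<open>Trigonometric polynomials\<close>

definition nsq :: "int \<times> int \<Rightarrow> int" where
  "nsq p = (fst p)\<^sup>2 + (snd p)\<^sup>2"

definition cross :: "int \<times> int \<Rightarrow> int \<times> int \<Rightarrow> int" where
  "cross p q = fst p * snd q - snd p * fst q"

lemma nsq_eq_0_iff: "nsq p = 0 \<longleftrightarrow> p = 0"
  by (cases p) (simp add: nsq_def zero_prod_def)

lemma nsq_minus [simp]: "nsq (- p) = nsq p"
  by (simp add: nsq_def)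

section \<open>Exponentials and their integrals\<close>

lemma ek_add: "ek (p + q) x = ek p x * ek q x"
  by (simp add: ek_def cis_mult algebra_simps)

lemma cnj_ek: "cnj (ek p x) = ek (- p) x"
  by (simp add: ek_def cis_cnj)

lemma ek_periodic: "ek p (x + 2 * pi, y) = ek p (x, y)" "ek p (x, y + 2 * pi) = ek p (x, y)"
proof -
  have 1: "cis (of_int n * (2 * pi)) = 1" for n :: int
    using cis_multiple_2pi[of "of_int n"] by (simp add: mult.commute)
  have "ek p (x + 2 * pi, y) = ek p (x, y) * cis (of_int (fst p) * (2 * pi))"
    "ek p (x, y + 2 * pi) = ek p (x, y) * cis (of_int (snd p) * (2 * pi))"
    by (simp_all add: ek_def cis_mult algebra_simps)
  then show "ek p (x + 2 * pi, y) = ek p (x, y)" "ek p (x, y + 2 * pi) = ek p (x, y)"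
    by (simp_all only: 1 mult_1_right)
qed

lemma ek_Iinv: "ek p (Iinv x) = cis (of_int (snd p) * pi) * ek (- fst p, snd p) x"
proof -
  have "cis (of_int (fst p) * (2 * pi)) = 1"
    using cis_multiple_2pi[of "of_int (fst p)"] by (simp add: mult.commute)
  moreover have "ek p (Iinv x) =
      cis (of_int (fst p) * (2 * pi)) * (cis (of_int (snd p) * pi) * ek (- fst p, snd p) x)"
    by (simp add: ek_def Iinv_def cis_mult algebra_simps)
  ultimately show ?thesis by simp
qed

lemma continuous_on_ek: "continuous_on A (ek p)"
  unfolding ek_def [abs_def] by (intro continuous_intros)

lemma cis_has_vector_derivative:
  "((\<lambda>t. cis (\<alpha> * t + \<beta>)) has_vector_derivative (\<i> * of_real \<alpha> * cis (\<alpha> * x + \<beta>))) (at x within A)"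
proof -
  have "((\<lambda>z. exp (\<i> * (of_real \<alpha> * z + of_real \<beta>))) has_field_derivative
      (\<i> * of_real \<alpha> * exp (\<i> * (of_real \<alpha> * of_real x + of_real \<beta>)))) (at (of_real x))"
    by (auto intro!: derivative_eq_intros)
  from has_vector_derivative_real_field[OF this, of A] show ?thesis by (simp add: cis_conv_exp)
qed

lemma ek_has_vector_derivative:
  "((\<lambda>t. ek p (t, y)) has_vector_derivative (\<i> * of_int (fst p) * ek p (x, y))) (at x)"
  "((\<lambda>t. ek p (x, t)) has_vector_derivative (\<i> * of_int (snd p) * ek p (x, y))) (at y)"
  using cis_has_vector_derivative[of "of_int (fst p)" "of_int (snd p) * y" x UNIV]
    cis_has_vector_derivative[of "of_int (snd p)" "of_int (fst p) * x" y UNIV]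
  by (simp_all add: ek_def add.commute)

lemma has_integral_cis:
  "((\<lambda>t. cis (of_int n * t)) has_integral (if n = 0 then of_real (2 * pi) else 0)) {0..2*pi}"
proof (cases "n = 0")
  case True
  then show ?thesis
    using has_integral_const_real[of "1::complex" 0 "2*pi"] by (simp add: scaleR_conv_of_real)
next
  case False
  have "((\<lambda>t. cis (of_int n * t)) has_integral
      (cis (of_int n * (2*pi)) / (\<i> * of_int n) - cis (of_int n * 0) / (\<i> * of_int n))) {0..2*pi}"
  proof (rule fundamental_theorem_of_calculus)
    fix x
    show "((\<lambda>t. cis (of_int n * t) / (\<i> * of_int n)) has_vector_derivative cis (of_int n * x))
        (at x within {0..2*pi})"
      using has_vector_derivative_divide[OF cis_has_vector_derivative[of "of_int n" 0 x], of "\<i> * of_int n"] False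
      by simp
  qed simp
  moreover have "cis (of_int n * (2*pi)) = 1"
    using cis_multiple_2pi[of "of_int n"] by (simp add: mult.commute)
  ultimately show ?thesis using False by simp
qed

lemma has_integral_ek:
  "(ek p has_integral (if p = 0 then of_real S_T else 0)) torus_box"
proof -
  have "integral torus_box (ek p)
      = integral (cbox 0 (2*pi)) (\<lambda>x. integral (cbox 0 (2*pi)) (\<lambda>y. ek p (x, y)))"
    unfolding torus_box_def by (intro integral_prod_continuous continuous_on_ek)
  also have "\<dots> = integral {0..2*pi} (\<lambda>x. cis (of_int (fst p) * x) *
      integral {0..2*pi} (\<lambda>y. cis (of_int (snd p) * y)))"
    by (simp add: ek_def cis_mult [symmetric])
  also have "\<dots> = (if fst p = 0 then of_real (2 * pi) else 0) * (if snd p = 0 then of_real (2 * pi) else 0)"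
    by (simp add: integral_unique[OF has_integral_cis])
  also have "\<dots> = (if p = 0 then of_real S_T else 0)"
    by (cases p) (simp add: S_T_def zero_prod_def power2_eq_square)
  finally have "integral torus_box (ek p) = (if p = 0 then of_real S_T else 0)" .
  moreover have "ek p integrable_on torus_box"
    unfolding torus_box_def by (intro integrable_continuous continuous_on_ek)
  ultimately show ?thesis by (metis integrable_integral)
qed

section \<open>Real functions as finite exponential sums\<close>

definition tr :: "'i set \<Rightarrow> ('i \<Rightarrow> int \<times> int) \<Rightarrow> ('i \<Rightarrow> complex) \<Rightarrow> real \<times> real \<Rightarrow> complex" where
  "tr I k c x = (\<Sum>i\<in>I. c i * ek (k i) x)"

text \<open>Frequencies may repeat and the coefficients need not be Hermitian: the representation is
  indexed so that products of trigonometric polynomials need no collecting of terms.\<close>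
definition trep :: "fn2 \<Rightarrow> 'i set \<Rightarrow> ('i \<Rightarrow> int \<times> int) \<Rightarrow> ('i \<Rightarrow> complex) \<Rightarrow> bool" where
  "trep f I k c \<longleftrightarrow> finite I \<and> (\<forall>x. of_real (f x) = tr I k c x)"

lemma trep_unique: "trep f I k c \<Longrightarrow> trep g I k c \<Longrightarrow> f = g"
  unfolding trep_def fun_eq_iff by (metis of_real_eq_iff)

lemma trep_fun_eq: "trep f I k c \<Longrightarrow> (\<lambda>x. complex_of_real (f x)) = tr I k c"
  unfolding trep_def by blast

lemma trep_cong:
  assumes "trep f I k c" "\<And>i. i \<in> I \<Longrightarrow> k i = k' i" "\<And>i. i \<in> I \<Longrightarrow> c i = c' i"
  shows "trep f I k' c'"
  using assms by (simp add: trep_def tr_def)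

lemma continuous_on_tr: "continuous_on A (tr I k c)"
  unfolding tr_def[abs_def] by (intro continuous_intros continuous_on_ek)

text \<open>Derivatives are computed on complex sums. The imaginary part of a real-valued curve is
  constantly 0, so its complex derivative is real and again represents a real function.\<close>

lemma real_part_derivative:
  assumes d: "(g has_vector_derivative D) (at t)" and g: "\<And>t. g t = complex_of_real (f t)"
  shows "(f has_real_derivative Re D) (at t)" "of_real (Re D) = D"
proof -
  have "((\<lambda>t. Re (g t)) has_vector_derivative Re D) (at t)"
    by (rule bounded_linear.has_vector_derivative[OF bounded_linear_Re d])
  then show "(f has_real_derivative Re D) (at t)"
    by (simp add: g has_real_derivative_iff_has_vector_derivative)
  have "((\<lambda>t. Im (g t)) has_vector_derivative Im D) (at t)"
    by (rule bounded_linear.has_vector_derivative[OF bounded_linear_Im d])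
  then have "((\<lambda>t. 0::real) has_vector_derivative Im D) (at t)" by (simp add: g)
  then have "Im D = 0"
    by (rule vector_derivative_unique_at) (rule has_vector_derivative_const)
  then show "of_real (Re D) = D" by (simp add: complex_eq_iff)
qed

lemma trep_has_d1:
  assumes f: "trep f I k c"
  obtains f' where "has_d1 f f'" "trep f' I k (\<lambda>i. \<i> * of_int (fst (k i)) * c i)"
proof
  let ?D = "tr I k (\<lambda>i. \<i> * of_int (fst (k i)) * c i)"
  have D: "((\<lambda>t. tr I k c (t, y)) has_vector_derivative ?D (x, y)) (at x)" for x y
    unfolding tr_def
    by (rule derivative_eq_intros ek_has_vector_derivative has_vector_derivative_mult_right refl)+
      (simp add: algebra_simps)
  have r: "((\<lambda>t. f (t, y)) has_real_derivative Re (?D (x, y))) (at x)"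
    "of_real (Re (?D (x, y))) = ?D (x, y)" for x y
    using real_part_derivative[OF D[of y x], where f = "\<lambda>t. f (t, y)"] f by (auto simp: trep_def)
  show "has_d1 f (\<lambda>x. Re (?D x))"
    unfolding has_d1_def using r(1) f by (auto simp: trep_def)
  show "trep (\<lambda>x. Re (?D x)) I k (\<lambda>i. \<i> * of_int (fst (k i)) * c i)"
    using r(2) f by (auto simp: trep_def)
qed

lemma trep_has_d2:
  assumes f: "trep f I k c"
  obtains f' where "has_d2 f f'" "trep f' I k (\<lambda>i. \<i> * of_int (snd (k i)) * c i)"
proof
  let ?D = "tr I k (\<lambda>i. \<i> * of_int (snd (k i)) * c i)"
  have D: "((\<lambda>t. tr I k c (x, t)) has_vector_derivative ?D (x, y)) (at y)" for x y
    unfolding tr_def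
    by (rule derivative_eq_intros ek_has_vector_derivative has_vector_derivative_mult_right refl)+
      (simp add: algebra_simps)
  have r: "((\<lambda>t. f (x, t)) has_real_derivative Re (?D (x, y))) (at y)"
    "of_real (Re (?D (x, y))) = ?D (x, y)" for x y
    using real_part_derivative[OF D[of x y], where f = "\<lambda>t. f (x, t)"] f by (auto simp: trep_def)
  show "has_d2 f (\<lambda>x. Re (?D x))"
    unfolding has_d2_def using r(1) f by (auto simp: trep_def)
  show "trep (\<lambda>x. Re (?D x)) I k (\<lambda>i. \<i> * of_int (snd (k i)) * c i)"
    using r(2) f by (auto simp: trep_def)
qed

lemma trep_d1: "trep f I k c \<Longrightarrow> trep (d1 f) I k (\<lambda>i. \<i> * of_int (fst (k i)) * c i)"
  by (metis trep_has_d1 d1_eqI)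

lemma trep_d2: "trep f I k c \<Longrightarrow> trep (d2 f) I k (\<lambda>i. \<i> * of_int (snd (k i)) * c i)"
  by (metis trep_has_d2 d2_eqI)

text \<open>Differentiation changes only the coefficients, so the coinduction keeps the index set
  and the frequencies fixed.\<close>

lemma trep_smooth2:
  assumes "trep f I k c" shows "smooth2 f"
proof (rule smooth2_coinduct_has[where X = "\<lambda>f. \<exists>c. trep f I k c"])
  show "\<exists>c. trep f I k c" using assms by blast
next
  fix f assume "\<exists>c. trep f I k c"
  then obtain c where f: "trep f I k c" ..
  then have "f = (\<lambda>x. Re (tr I k c x))" unfolding trep_def fun_eq_iff by (metis Re_complex_of_real)
  moreover have "continuous_on UNIV (\<lambda>x. Re (tr I k c x))"
    by (intro continuous_intros continuous_on_tr)
  ultimately have "continuous_on UNIV f" by simp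
  then show "continuous_on UNIV f \<and>
      (\<exists>f1 f2. has_d1 f f1 \<and> has_d2 f f2 \<and> (\<exists>c. trep f1 I k c) \<and> (\<exists>c. trep f2 I k c))"
    by (metis f trep_has_d1 trep_has_d2)
qed

lemma trep_periodic2: "trep f I k c \<Longrightarrow> periodic2 f"
  unfolding trep_def periodic2_def tr_def by (metis (no_types, lifting) ek_periodic of_real_eq_iff sum.cong)

text \<open>Both orders multiply a coefficient by the same two scalars.\<close>

lemma trep_mixed: 
  assumes "trep f I k c" shows "d1 (d2 f) = d2 (d1 f)"
  by (rule trep_unique[OF trep_cong[OF trep_d1[OF trep_d2[OF assms]]] trep_d2[OF trep_d1[OF assms]]])
    auto

lemma trep_add: "trep f I k c \<Longrightarrow> trep g I k d \<Longrightarrow> trep (\<lambda>x. f x + g x) I k (\<lambda>i. c i + d i)"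
  by (simp add: trep_def tr_def sum.distrib distrib_right)

lemma trep_cmult: "trep f I k c \<Longrightarrow> trep (\<lambda>x. r * f x) I k (\<lambda>i. of_real r * c i)"
  by (simp add: trep_def tr_def sum_distrib_left mult.assoc)

lemma trep_diff: "trep f I k c \<Longrightarrow> trep g I k d \<Longrightarrow> trep (\<lambda>x. f x - g x) I k (\<lambda>i. c i - d i)"
  by (simp add: trep_def tr_def sum_subtractf left_diff_distrib)

lemma trep_mult:
  "trep f I k c \<Longrightarrow> trep g J l d \<Longrightarrow>
    trep (\<lambda>x. f x * g x) (I \<times> J) (\<lambda>(i, j). k i + l j) (\<lambda>(i, j). c i * d j)"
  by (auto simp: trep_def tr_def sum_product sum.cartesian_product ek_add algebra_simps intro!: sum.cong)

text \<open>Products are indexed by pairs in the order of the factors, so B(v, u) must be reindexed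
  before it is combined with {u, v} and B(u, v).\<close>

lemma trep_swap:
  assumes "trep f (J \<times> I) (\<lambda>(j, i). k j i) (\<lambda>(j, i). c j i)"
  shows "trep f (I \<times> J) (\<lambda>(i, j). k j i) (\<lambda>(i, j). c j i)"
proof (cases "I = {} \<or> J = {}")
  case True
  then show ?thesis using assms by (auto simp: trep_def tr_def)
next
  case False
  have "tr (J \<times> I) (\<lambda>(j, i). k j i) (\<lambda>(j, i). c j i) x = tr (I \<times> J) (\<lambda>(i, j). k j i) (\<lambda>(i, j). c j i) x" for x
    unfolding tr_def by (rule sum.reindex_bij_witness[of _ prod.swap prod.swap]) auto
  moreover have "finite (I \<times> J)" using assms finite_cartesian_product_iff[of J I] False
    by (auto simp: trep_def)
  ultimately show ?thesis using assms by (simp add: trep_def)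
qed

lemma trep_lap: "trep f I k c \<Longrightarrow> trep (lap f) I k (\<lambda>i. - of_int (nsq (k i)) * c i)"
  unfolding lap_def
  by (rule trep_cong[OF trep_add[OF trep_d1[OF trep_d1] trep_d2[OF trep_d2]]])
    (auto simp: nsq_def algebra_simps power2_eq_square)

text \<open>The two factors \<open>\<i>\<close> from the derivatives multiply to -1, which turns k2
  l1 - k1 l2 into the cross product with a plus sign.\<close>

lemma trep_pbr:
  assumes "trep f I k c" "trep g J l d"
  shows "trep (pbr f g) (I \<times> J) (\<lambda>(i, j). k i + l j) (\<lambda>(i, j). of_int (cross (k i) (l j)) * c i * d j)"
  unfolding pbr_def
  by (rule trep_cong[OF trep_diff[OF trep_mult[OF trep_d2[OF assms(1)] trep_d1[OF assms(2)]]
        trep_mult[OF trep_d1[OF assms(1)] trep_d2[OF assms(2)]]]])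
    (auto simp: cross_def algebra_simps)

lemma has_integral_tr:
  "finite I \<Longrightarrow> (tr I k c has_integral of_real S_T * (\<Sum>i\<in>I. if k i = 0 then c i else 0)) torus_box"
proof -
  assume "finite I"
  then have "((\<lambda>x. \<Sum>i\<in>I. c i * ek (k i) x) has_integral
      (\<Sum>i\<in>I. c i * (if k i = 0 then of_real S_T else 0))) torus_box"
    by (intro has_integral_sum has_integral_mult_right has_integral_ek)
  moreover have "(\<Sum>i\<in>I. c i * (if k i = 0 then of_real S_T else 0))
      = of_real S_T * (\<Sum>i\<in>I. if k i = 0 then c i else 0)"
    by (auto simp: sum_distrib_left intro!: sum.cong)
  ultimately show ?thesis by (simp add: tr_def[abs_def])
qed

lemma integral_trep:
  assumes f: "trep f I k c"
  shows "of_real (integral torus_box f) = of_real S_T * (\<Sum>i\<in>I. if k i = 0 then c i else 0)"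
proof -
  have "(f has_integral integral torus_box f) torus_box"
    using smooth2_integrable[OF trep_smooth2[OF f]] by (rule integrable_integral)
  from has_integral_linear[OF this bounded_linear_of_real]
  have "((\<lambda>x. complex_of_real (f x)) has_integral of_real (integral torus_box f)) torus_box"
    by (simp add: o_def)
  then have "(tr I k c has_integral of_real (integral torus_box f)) torus_box"
    by (simp add: trep_fun_eq[OF f] del: split_paired_All)
  moreover have "finite I" using f by (simp add: trep_def)
  ultimately show ?thesis
    using has_integral_unique[OF _ has_integral_tr] by blast
qed

text \<open>grad e_p . grad e_q = -(p . q) e_{p+q}, and only frequency 0 has a nonzero integral;
  there q = -p, so the factor is |p|^2.\<close>

lemma ip_trep:
  assumes "trep f I k c" "trep g J l d"
  shows "of_real (ip f g) = of_real S_T *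
    (\<Sum>(i, j)\<in>I \<times> J. if k i + l j = 0 then of_int (nsq (k i)) * c i * d j else 0)"
proof -
  let ?c = "\<lambda>(i, j). - of_int (fst (k i) * fst (l j) + snd (k i) * snd (l j)) * c i * d j"
  have "trep (\<lambda>x. d1 f x * d1 g x + d2 f x * d2 g x) (I \<times> J) (\<lambda>(i, j). k i + l j) ?c"
    by (rule trep_cong[OF trep_add[OF trep_mult[OF trep_d1[OF assms(1)] trep_d1[OF assms(2)]]
        trep_mult[OF trep_d2[OF assms(1)] trep_d2[OF assms(2)]]]])
      (auto simp: algebra_simps)
  from integral_trep[OF this] have "of_real (ip f g) = of_real S_T *
      (\<Sum>ij\<in>I \<times> J. if (case ij of (i, j) \<Rightarrow> k i + l j) = 0 then ?c ij else 0)"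
    by (simp add: ip_def)
  also have "(\<Sum>ij\<in>I \<times> J. if (case ij of (i, j) \<Rightarrow> k i + l j) = 0 then ?c ij else 0)
    = (\<Sum>(i, j)\<in>I \<times> J. if k i + l j = 0 then of_int (nsq (k i)) * c i * d j else 0)"
  proof -
    have "?c (i, j) = of_int (nsq (k i)) * c i * d j" if "k i + l j = 0" for i j
    proof -
      have "l j = - k i" using that by (simp add: eq_neg_iff_add_eq_0 add.commute)
      then show ?thesis by (simp add: nsq_def power2_eq_square)
    qed
    then show ?thesis by (intro sum.cong) auto
  qed
  finally show ?thesis .
qed

section \<open>Uniqueness of Fourier coefficients and multipliers\<close>

lemma tr_shift: "tr I (\<lambda>i. k i + p) c x = tr I k c x * ek p x"
  by (simp add: tr_def ek_add sum_distrib_right mult.assoc)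

lemma tr_collect:
  assumes P: "finite P" "k ` I \<subseteq> P"
  shows "tr I k (\<lambda>i. m (k i) * c i) x = (\<Sum>p\<in>P. m p * ek p x * (\<Sum>i\<in>I. if k i = p then c i else 0))"
proof -
  have "(\<Sum>p\<in>P. m p * ek p x * (\<Sum>i\<in>I. if k i = p then c i else 0))
      = (\<Sum>p\<in>P. \<Sum>i\<in>I. if k i = p then m p * ek p x * c i else 0)"
    by (auto simp: sum_distrib_left intro!: sum.cong)
  also have "\<dots> = (\<Sum>i\<in>I. \<Sum>p\<in>P. if k i = p then m p * ek p x * c i else 0)" by (rule sum.swap)
  also have "\<dots> = tr I k (\<lambda>i. m (k i) * c i) x"
    unfolding tr_def using P by (intro sum.cong) (auto simp: image_subset_iff)
  finally show ?thesis by simp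
qed

text \<open>Multiplication by e_{-p} moves frequency p to 0, where integration over the torus reads
  off its total coefficient.\<close>

lemma tr_coeff_unique:
  assumes fin: "finite I" "finite J" and eq: "\<And>x. tr I k c x = tr J l d x"
  shows "(\<Sum>i\<in>I. if k i = p then c i else 0) = (\<Sum>j\<in>J. if l j = p then d j else 0)"
proof -
  have "tr I (\<lambda>i. k i + - p) c = tr J (\<lambda>j. l j + - p) d"
    by (rule ext) (simp only: tr_shift eq)
  then have "of_real S_T * (\<Sum>i\<in>I. if k i + - p = 0 then c i else 0)
      = complex_of_real S_T * (\<Sum>j\<in>J. if l j + - p = 0 then d j else 0)"
    using has_integral_tr[OF fin(1), of "\<lambda>i. k i + - p" c] has_integral_tr[OF fin(2), of "\<lambda>j. l j + - p" d]
    by (simp only: has_integral_unique)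
  then show ?thesis by (simp add: S_T_def)
qed

text \<open>A Fourier multiplier depends on the function and not on the chosen expansion. This
  allows symmetries of a function, which relate two different expansions, to be transferred to its
  inverse Laplacian.\<close>

lemma tr_multiplier:
  assumes fin: "finite I" "finite J" and eq: "\<And>x. tr I k c x = tr J l d x"
  shows "tr I k (\<lambda>i. m (k i) * c i) x = tr J l (\<lambda>j. m (l j) * d j) x"
  using tr_collect[of "k ` I \<union> l ` J" k I m c x] tr_collect[of "k ` I \<union> l ` J" l J m d x] fin
    tr_coeff_unique[OF fin eq] by simp

section \<open>The connection on trigonometric polynomials\<close>

lemma inverse_laplacian:
  assumes g: "trep g I k c" and odd: "\<And>x. g (Iinv x) = - g x"
    and zero: "\<And>i. i \<in> I \<Longrightarrow> k i = 0 \<Longrightarrow> c i = 0"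
  obtains w where "w \<in> lie_alg" "lap w = g" "trep w I k (\<lambda>i. - c i / of_int (nsq (k i)))"
proof
  let ?m = "\<lambda>p. - 1 / complex_of_int (nsq p)"
  let ?c = "\<lambda>i. - c i / of_int (nsq (k i))"
  let ?w = "\<lambda>x. Re (tr I k ?c x)"
  have fin: "finite I" and g': "\<And>x. of_real (g x) = tr I k c x" using g by (auto simp: trep_def)
  have cnj: "cnj (tr I k c x) = tr I (\<lambda>i. - k i) (\<lambda>i. cnj (c i)) x" for c x
    by (simp add: tr_def cnj_ek)
  have "tr I k c x = tr I (\<lambda>i. - k i) (\<lambda>i. cnj (c i)) x" for x
    using cnj[of c x] by (simp flip: g')
  \<comment> \<open>\<open>g\<close> real means that (k, c) and (-k, conjugate of c) expand the same
    function. The multiplier is real and even, so the new sum also equals its conjugate.\<close>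
  from tr_multiplier[OF fin fin this, of ?m]
  have "cnj (tr I k ?c x) = tr I k ?c x" for x
    unfolding cnj by simp
  then have real: "of_real (?w x) = tr I k ?c x" for x
    by (metis of_real_Re Reals_cnj_iff)
  show w: "trep ?w I k ?c" using fin real by (simp add: trep_def)
  show "lap ?w = g"
  proof (rule trep_unique[OF trep_cong[OF trep_lap[OF w]] g])
    \<comment> \<open>At frequency 0 division by zero yields 0, which agrees with \<open>c i\<close>
      by the hypothesis \<open>zero\<close>.\<close>
    show "- of_int (nsq (k i)) * ?c i = c i" if "i \<in> I" for i
      using zero[OF that] by (cases "k i = 0") (simp_all add: nsq_eq_0_iff)
  qed simp
  have refl: "tr I k c (Iinv x) =
      tr I (\<lambda>i. (- fst (k i), snd (k i))) (\<lambda>i. cis (of_int (snd (k i)) * pi) * c i) x" for c x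
    by (simp add: tr_def ek_Iinv algebra_simps)
  \<comment> \<open>Oddness in terms of expansions: I reflects the first frequency component and
    inserts a factor depending on the second. The multiplier is blind to the reflection.\<close>
  have "tr I (\<lambda>i. (- fst (k i), snd (k i))) (\<lambda>i. cis (of_int (snd (k i)) * pi) * c i) x
      = tr I k (\<lambda>i. - c i) x" for x
    using g'[of "Iinv x"] odd[of x] g'[of x] by (simp add: refl) (simp add: tr_def sum_negf)
  from tr_multiplier[OF fin fin this, of ?m]
  have "tr I k ?c (Iinv x) = - tr I k ?c x" for x
    unfolding refl by (simp add: nsq_def tr_def algebra_simps flip: sum_negf)
  then have "?w (Iinv x) = - ?w x" for x by simp
  moreover have "integral torus_box ?w = 0"
  proof -
    have "(\<Sum>i\<in>I. if k i = 0 then ?c i else 0) = 0" by (rule sum.neutral) (auto simp: nsq_def)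
    then show ?thesis using integral_trep[OF w] by simp
  qed
  ultimately show "?w \<in> lie_alg"
    using trep_smooth2[OF w] trep_periodic2[OF w] by (simp add: lie_alg_iff)
qed

lemma Bop_trep:
  assumes u: "u \<in> lie_alg" "trep u I k c" and v: "v \<in> lie_alg" "trep v J l d"
  shows "Bop u v \<in> lie_alg"
    and "trep (Bop u v) (I \<times> J) (\<lambda>(i, j). k i + l j)
      (\<lambda>(i, j). of_int (cross (k i) (l j)) * of_int (nsq (k i)) / of_int (nsq (k i + l j)) * c i * d j)"
proof -
  let ?g = "pbr (lap u) v"
  let ?c = "\<lambda>(i, j). - of_int (nsq (k i) * cross (k i) (l j)) * c i * d j"
  have su: "smooth2 u" and sv: "smooth2 v" using u v by (auto simp: lie_alg_iff)
  have g: "trep ?g (I \<times> J) (\<lambda>(i, j). k i + l j) ?c"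
    by (rule trep_cong[OF trep_pbr[OF trep_lap[OF u(2)] v(2)]]) auto
  have "u (Iinv x) = (- 1) * u x" "v (Iinv x) = (- 1) * v x" for x
    using u v by (simp_all add: lie_alg_odd)
  then have odd: "?g (Iinv x) = - ?g x" for x
    using pbr_Iinv[OF smooth2_lap[OF su] sv lap_Iinv[OF su], of "- 1" "- 1"] by simp
  \<comment> \<open>The zero-frequency terms of {lap u, v} pair p with -p, whose cross product is
    0.\<close>
  have "?c ij = 0" if "(case ij of (i, j) \<Rightarrow> k i + l j) = 0" for ij
  proof -
    obtain i j where ij: "ij = (i, j)" by (cases ij)
    with that have "l j = - k i" by (simp add: eq_neg_iff_add_eq_0 add.commute)
    then show ?thesis by (simp add: ij cross_def)
  qed
  then obtain w where w: "w \<in> lie_alg" "lap w = ?g"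
    and t: "trep w (I \<times> J) (\<lambda>(i, j). k i + l j)
      (\<lambda>ij. - ?c ij / of_int (nsq (case ij of (i, j) \<Rightarrow> k i + l j)))"
    using inverse_laplacian[OF g odd] by blast
  have B: "Bop u v = w"
    by (rule Bop_eq_if_lap_eq[OF w(1) u(1) v(1) trep_mixed[OF v(2)] w(2)])
  show "Bop u v \<in> lie_alg" using w(1) B by simp
  show "trep (Bop u v) (I \<times> J) (\<lambda>(i, j). k i + l j)
      (\<lambda>(i, j). of_int (cross (k i) (l j)) * of_int (nsq (k i)) / of_int (nsq (k i + l j)) * c i * d j)"
    unfolding B by (rule trep_cong[OF t]) auto
qed

text \<open>The coefficient of \<nabla>_{e_p} e_q at e_{p+q}. The last summand comes from B(v, u),
  whose cross product has the opposite sign. For q = -p the value is 0 whatever the quotients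
  are.\<close>

definition Gam :: "int \<times> int \<Rightarrow> int \<times> int \<Rightarrow> complex" where
  "Gam p q = of_int (cross p q) / 2 *
     (1 - of_int (nsq p) / of_int (nsq (p + q)) + of_int (nsq q) / of_int (nsq (p + q)))"

lemma conn_trep:
  assumes u: "u \<in> lie_alg" "trep u I k c" and v: "v \<in> lie_alg" "trep v J l d"
  shows "conn u v \<in> lie_alg"
    and "trep (conn u v) (I \<times> J) (\<lambda>(i, j). k i + l j) (\<lambda>(i, j). Gam (k i) (l j) * c i * d j)"
proof -
  show "conn u v \<in> lie_alg"
    unfolding conn_def
    by (intro lie_alg_cmult lie_alg_diff lie_alg_pbr Bop_trep(1)[OF u v] Bop_trep(1)[OF v u]
        u v trep_mixed[OF v(2)])
  have "trep (Bop v u) (I \<times> J) (\<lambda>(i, j). l j + k i)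
     (\<lambda>(i, j). of_int (cross (l j) (k i)) * of_int (nsq (l j)) / of_int (nsq (l j + k i)) * d j * c i)"
    by (rule trep_swap[OF Bop_trep(2)[OF v u]])
  then have B: "trep (Bop v u) (I \<times> J) (\<lambda>(i, j). k i + l j)
     (\<lambda>(i, j). - of_int (cross (k i) (l j)) * of_int (nsq (l j)) / of_int (nsq (k i + l j)) * c i * d j)"
    by (rule trep_cong) (auto simp: cross_def algebra_simps minus_divide_left[symmetric])
  show "trep (conn u v) (I \<times> J) (\<lambda>(i, j). k i + l j) (\<lambda>(i, j). Gam (k i) (l j) * c i * d j)"
    unfolding conn_def
    by (rule trep_cong[OF trep_cmult[OF trep_diff[OF trep_diff[OF trep_pbr[OF u(2) v(2)] Bop_trep(2)[OF u v]] B]]])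
      (auto simp: Gam_def algebra_simps add_divide_distrib diff_divide_distrib)
qed

section \<open>Sectional curvature\<close>

lemma collapse_quadruple_sum:
  fixes K L :: "(int \<times> int) set" and F :: "_ \<Rightarrow> _ \<Rightarrow> _ \<Rightarrow> _ \<Rightarrow> complex"
  assumes fin: "finite K" "finite L"
    and K: "\<And>p. p \<in> K \<Longrightarrow> - p \<in> K" and L: "\<And>q. q \<in> L \<Longrightarrow> - q \<in> L"
    and sep: "\<And>p q r s. p \<in> K \<Longrightarrow> q \<in> L \<Longrightarrow> r \<in> K \<Longrightarrow> s \<in> L \<Longrightarrow> p + q + r + s = 0 \<Longrightarrow> r = - p \<and> s = - q"
  shows "(\<Sum>p\<in>K. \<Sum>q\<in>L. \<Sum>r\<in>K. \<Sum>s\<in>L. if p + q + r + s = 0 then F p q r s else 0)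
    = (\<Sum>p\<in>K. \<Sum>q\<in>L. F p q (- p) (- q))"
proof (intro sum.cong refl)
  fix p q assume p: "p \<in> K" and q: "q \<in> L"
  have "(\<Sum>r\<in>K. \<Sum>s\<in>L. if p + q + r + s = 0 then F p q r s else 0)
      = (\<Sum>r\<in>K. \<Sum>s\<in>L. if s = - q then (if r = - p then F p q (- p) (- q) else 0) else 0)"
  proof (intro sum.cong refl)
    fix r s assume "r \<in> K" "s \<in> L"
    then have "p + q + r + s = 0 \<longleftrightarrow> r = - p \<and> s = - q"
      using sep[OF p q] by (metis add.commute add_cancel_left_right add.assoc add.right_inverse)
    then show "(if p + q + r + s = 0 then F p q r s else 0)
        = (if s = - q then (if r = - p then F p q (- p) (- q) else 0) else 0)" by simp
  qed
  also have "\<dots> = F p q (- p) (- q)"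
    using fin K[OF p] L[OF q] by (simp add: sum.delta)
  finally show "(\<Sum>r\<in>K. \<Sum>s\<in>L. if p + q + r + s = 0 then F p q r s else 0) = F p q (- p) (- q)" .
qed

text \<open>The left side collects, for the quadruple (p, q, -p, -q), the contributions of
  -\<nabla>_u \<nabla>_v u and \<nabla>_{{u,v}} u; the identity is where Arnold's weight
  arises.\<close>

lemma curvature_coeff:
  "- (Gam p (q - p) * Gam q (- p)) * of_int (nsq q)
     + of_int (cross p q) * Gam (p + q) (- p) * of_int (nsq q)
   = - (of_int (cross p q) ^ 4 / of_int (nsq (q - p)))"
\<comment> \<open>Parallel frequencies include q = 0 and q = p, the cases with a vanishing
  denominator; all terms are 0 there.\<close>
proof (cases "cross p q = 0")
  case True
  then have "cross p (q - p) = 0" "cross (p + q) (- p) = 0"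
    by (simp_all add: cross_def algebra_simps)
  then show ?thesis using True by (simp add: Gam_def)
next
  case False
  define P Q t c N :: complex where "P = of_int (nsq p)" "Q = of_int (nsq q)"
    "t = of_int (fst p * fst q + snd p * snd q)" "c = of_int (cross p q)" "N = of_int (nsq (q - p))"
  note defs = this
  have Q: "Q \<noteq> 0" and N: "N \<noteq> 0"
    using False unfolding defs by (auto simp: nsq_eq_0_iff cross_def)
  have M: "of_int (nsq (p + q)) = P + Q + 2 * t" and N': "N = P + Q - 2 * t" and cc: "c\<^sup>2 = P * Q - t\<^sup>2"
    by (simp_all add: defs nsq_def cross_def power2_eq_square algebra_simps)
  have cr: "cross p (q - p) = cross p q" "cross q (- p) = cross p q" "cross (p + q) (- p) = cross p q"
    by (simp_all add: cross_def algebra_simps)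
  have "Gam p (q - p) = c / 2 * (1 - P / Q + N / Q)"
    by (simp add: Gam_def cr defs)
  also have "\<dots> = c * (Q - t) / Q"
    using Q by (simp add: N' field_simps)
  finally have G1: "Gam p (q - p) = c * (Q - t) / Q" .
  have "Gam q (- p) = c / 2 * (1 - Q / N + P / N)"
    by (simp add: Gam_def cr defs)
  also have "\<dots> = c * (P - t) / N"
    using N by (simp add: field_simps) (simp add: N' algebra_simps)
  finally have G2: "Gam q (- p) = c * (P - t) / N" .
  have "Gam (p + q) (- p) = c / 2 * (1 - (P + Q + 2 * t) / Q + P / Q)"
    by (simp add: Gam_def cr M defs(1,2,4))
  also have "\<dots> = - c * t / Q"
    using Q by (simp add: field_simps)
  finally have G3: "Gam (p + q) (- p) = - c * t / Q" .
  have "- (Gam p (q - p) * Gam q (- p)) * Q + c * Gam (p + q) (- p) * Q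
      = - (c\<^sup>2 * ((Q - t) * (P - t) / N + t))"
    using Q N by (simp add: G1 G2 G3 power2_eq_square field_simps)
  \<comment> \<open>With N = P + Q - 2 t, the numerator (Q - t)(P - t) + t N reduces to P Q - t^2,
    which is c^2 by Lagrange's identity.\<close>
  also have "(Q - t) * (P - t) / N + t = c\<^sup>2 / N"
    using N by (simp add: field_simps cc) (simp add: N' power2_eq_square algebra_simps)
  finally show ?thesis by (simp add: defs power2_eq_square power4_eq_xxxx mult.assoc)
qed

lemma ip_Rcurv_trep:
  assumes u: "u \<in> lie_alg" "trep u K (\<lambda>p. p) A" and v: "v \<in> lie_alg" "trep v L (\<lambda>q. q) B"
    and K: "\<And>p. p \<in> K \<Longrightarrow> - p \<in> K" and L: "\<And>q. q \<in> L \<Longrightarrow> - q \<in> L"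
    and sep: "\<And>p q r s. p \<in> K \<Longrightarrow> q \<in> L \<Longrightarrow> r \<in> K \<Longrightarrow> s \<in> L \<Longrightarrow> p + q + r + s = 0 \<Longrightarrow> r = - p \<and> s = - q"
  shows "of_real (ip (Rcurv u v u) v) = - of_real S_T *
    (\<Sum>p\<in>K. \<Sum>q\<in>L. of_int (cross p q) ^ 4 / of_int (nsq (q - p)) * (A p * A (- p)) * (B q * B (- q)))"
proof -
  have fin: "finite K" "finite L" using u v by (auto simp: trep_def)
  have collapse: "(\<Sum>p\<in>K. \<Sum>q\<in>L. \<Sum>r\<in>K. \<Sum>s\<in>L. if p + q + r + s = 0 then F p q r s else 0)
      = (\<Sum>p\<in>K. \<Sum>q\<in>L. F p q (- p) (- q))" for F :: "_ \<Rightarrow> _ \<Rightarrow> _ \<Rightarrow> _ \<Rightarrow> complex"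
    by (rule collapse_quadruple_sum[OF fin]) (use K L sep in blast)+
  note vu = conn_trep[OF v u] and uu = conn_trep[OF u u]
  note t1 = conn_trep[OF u vu] and t2 = conn_trep[OF v uu]
  have p: "pbr u v \<in> lie_alg" using u v by (intro lie_alg_pbr trep_mixed[OF v(2)])
  note t3 = conn_trep[OF p trep_pbr[OF u(2) v(2)] u]
  let ?W = "\<lambda>p q. (A p * A (- p)) * (B q * B (- q))"
  have "of_real (ip (conn u (conn v u)) v) = of_real S_T *
     (\<Sum>p\<in>K. \<Sum>q\<in>L. \<Sum>r\<in>K. \<Sum>s\<in>L. if p + q + r + s = 0 then
        of_int (nsq (p + q + r)) * (Gam p (q + r) * A p * (Gam q r * B q * A r)) * B s else 0)"
    by (simp add: ip_trep[OF t1(2) v(2)] sum.cartesian_product' add.assoc cong: if_cong)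
  then have i1: "of_real (ip (conn u (conn v u)) v) = of_real S_T *
      (\<Sum>p\<in>K. \<Sum>q\<in>L. Gam p (q - p) * Gam q (- p) * of_int (nsq q) * ?W p q)"
    unfolding collapse by (simp add: algebra_simps)
  have "of_real (ip (conn v (conn u u)) v) = of_real S_T *
     (\<Sum>q\<in>L. \<Sum>p\<in>K. \<Sum>r\<in>K. \<Sum>s\<in>L. if p + q + r + s = 0 then
        of_int (nsq (p + q + r)) * (Gam q (p + r) * B q * (Gam p r * A p * A r)) * B s else 0)"
    by (simp add: ip_trep[OF t2(2) v(2)] sum.cartesian_product' ac_simps cong: if_cong)
  also have "\<dots> = of_real S_T *
     (\<Sum>p\<in>K. \<Sum>q\<in>L. \<Sum>r\<in>K. \<Sum>s\<in>L. if p + q + r + s = 0 then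
        of_int (nsq (p + q + r)) * (Gam q (p + r) * B q * (Gam p r * A p * A r)) * B s else 0)"
    by (subst sum.swap) (rule refl)
  \<comment> \<open>After collapsing, r = -p, and the inner factor \<open>Gam p (- p)\<close>
    vanishes: \<nabla>_v \<nabla>_u u contributes nothing.\<close>
  also have "\<dots> = 0"
    unfolding collapse by (simp add: Gam_def cross_def)
  finally have i2: "of_real (ip (conn v (conn u u)) v) = (0::complex)" .
  have "of_real (ip (conn (pbr u v) u) v) = of_real S_T *
     (\<Sum>p\<in>K. \<Sum>q\<in>L. \<Sum>r\<in>K. \<Sum>s\<in>L. if p + q + r + s = 0 then
        of_int (nsq (p + q + r)) * (Gam (p + q) r * (of_int (cross p q) * A p * B q) * A r) * B s else 0)"
    by (simp add: ip_trep[OF t3(2) v(2)] sum.cartesian_product' add.assoc cong: if_cong)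
  then have i3: "of_real (ip (conn (pbr u v) u) v) = of_real S_T *
      (\<Sum>p\<in>K. \<Sum>q\<in>L. of_int (cross p q) * Gam (p + q) (- p) * of_int (nsq q) * ?W p q)"
    unfolding collapse by (simp add: algebra_simps)
  have s: "smooth2 (conn u (conn v u))" "smooth2 (conn v (conn u u))" "smooth2 (conn (pbr u v) u)" "smooth2 v"
    using t1(1) t2(1) t3(1) v(1) by (auto simp: lie_alg_iff)
  have "ip (Rcurv u v u) v = ip (\<lambda>x. (conn v (conn u u) x - conn u (conn v u) x) + conn (pbr u v) u x) v"
    by (simp add: Rcurv_def add.commute)
  also have "\<dots> = ip (conn v (conn u u)) v - ip (conn u (conn v u)) v + ip (conn (pbr u v) u) v"
    using s by (simp add: ip_add_left ip_diff_left smooth2_diff)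
  finally have "complex_of_real (ip (Rcurv u v u) v) = of_real (ip (conn v (conn u u)) v)
      - of_real (ip (conn u (conn v u)) v) + of_real (ip (conn (pbr u v) u) v)" by simp
  also have "\<dots> = of_real S_T * (\<Sum>p\<in>K. \<Sum>q\<in>L.
      (- (Gam p (q - p) * Gam q (- p)) * of_int (nsq q)
       + of_int (cross p q) * Gam (p + q) (- p) * of_int (nsq q)) * ?W p q)"
    unfolding i1 i2 i3 distrib_right sum.distrib by (simp add: right_diff_distrib sum_negf)
  finally show ?thesis
    unfolding curvature_coeff by (simp add: sum_negf mult.assoc)
qed

text \<open>Constant products \<alpha> and \<beta> come out of the curvature sum and cancel against
  the squared norms, whose sums leave only the cardinalities. Disjoint frequencies make u and v
  orthogonal.\<close>

lemma sec_curv_trep: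
  fixes \<alpha> \<beta> :: real and M N :: int
  assumes u: "u \<in> lie_alg" "trep u K (\<lambda>p. p) A" and v: "v \<in> lie_alg" "trep v L (\<lambda>q. q) B"
    and K: "\<And>p. p \<in> K \<Longrightarrow> - p \<in> K" and L: "\<And>q. q \<in> L \<Longrightarrow> - q \<in> L"
    and sep: "\<And>p q r s. p \<in> K \<Longrightarrow> q \<in> L \<Longrightarrow> r \<in> K \<Longrightarrow> s \<in> L \<Longrightarrow> p + q + r + s = 0 \<Longrightarrow> r = - p \<and> s = - q"
    and disj: "\<And>p q. p \<in> K \<Longrightarrow> q \<in> L \<Longrightarrow> p + q \<noteq> 0"
    and A: "\<And>p. p \<in> K \<Longrightarrow> A p * A (- p) = of_real \<alpha>" "\<alpha> \<noteq> 0"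
    and B: "\<And>q. q \<in> L \<Longrightarrow> B q * B (- q) = of_real \<beta>" "\<beta> \<noteq> 0"
    and M: "\<And>p. p \<in> K \<Longrightarrow> nsq p = M" and N: "\<And>q. q \<in> L \<Longrightarrow> nsq q = N"
  shows "sec_curv u v = - (\<Sum>p\<in>K. \<Sum>q\<in>L. of_int (cross p q) ^ 4 / of_int (nsq (q - p))) /
    (S_T * of_int M * of_int N * card K * card L)"
proof -
  have fin: "finite K" "finite L" using u v by (auto simp: trep_def)
  have self: "ip f f = S_T * of_int M * \<gamma> * card I"
    if f: "trep f I (\<lambda>p. p) C" and I: "\<And>p. p \<in> I \<Longrightarrow> - p \<in> I" and C: "\<And>p. p \<in> I \<Longrightarrow> C p * C (- p) = of_real \<gamma>"
      and M: "\<And>p. p \<in> I \<Longrightarrow> nsq p = M" for f I C \<gamma> M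
  proof -
    have fin: "finite I" using f by (simp add: trep_def)
    have "complex_of_real (ip f f) = of_real S_T *
        (\<Sum>p\<in>I. \<Sum>r\<in>I. if r = - p then of_int M * (C p * C (- p)) else 0)"
      unfolding ip_trep[OF f f] sum.cartesian_product'
    proof (intro arg_cong[of _ _ "(*) _"] sum.cong refl)
      fix p r assume "p \<in> I"
      moreover have "p + r = 0 \<longleftrightarrow> r = - p" by (metis add.commute eq_neg_iff_add_eq_0)
      ultimately show "(case (p, r) of (p, r) \<Rightarrow> if p + r = 0 then of_int (nsq p) * C p * C r else 0)
          = (if r = - p then of_int M * (C p * C (- p)) else 0)" by (simp add: M)
    qed
    also have "\<dots> = of_real (S_T * of_int M * \<gamma> * card I)"
      using fin I C by simp
    finally show ?thesis by (simp only: of_real_eq_iff)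
  qed
  have "complex_of_real (ip u v) = 0"
    unfolding ip_trep[OF u(2) v(2)] using disj by (auto intro!: sum.neutral)
  then have uv: "ip u v = 0" by simp
  have "complex_of_real (ip (Rcurv u v u) v) = - of_real S_T *
      (\<Sum>p\<in>K. \<Sum>q\<in>L. of_int (cross p q) ^ 4 / of_int (nsq (q - p)) * of_real \<alpha> * of_real \<beta>)"
    using A(1) B(1) by (subst ip_Rcurv_trep[OF u v]) (use K L sep in \<open>auto simp: mult.assoc\<close>)
  also have "\<dots> = of_real (- S_T * \<alpha> * \<beta> * (\<Sum>p\<in>K. \<Sum>q\<in>L. of_int (cross p q) ^ 4 / of_int (nsq (q - p))))"
    by (simp add: sum_distrib_left algebra_simps)
  finally have R: "ip (Rcurv u v u) v =
      - S_T * \<alpha> * \<beta> * (\<Sum>p\<in>K. \<Sum>q\<in>L. of_int (cross p q) ^ 4 / of_int (nsq (q - p)))"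
    by (simp only: of_real_eq_iff)
  have S: "S_T \<noteq> 0" by (simp add: S_T_def)
  have uu: "ip u u = S_T * of_int M * \<alpha> * card K"
    by (rule self[OF u(2)]) (use K A(1) M in auto)
  have vv: "ip v v = S_T * of_int N * \<beta> * card L"
    by (rule self[OF v(2)]) (use L B(1) N in auto)
  show ?thesis
    unfolding sec_curv_def R uv uu vv
    using A(2) B(2) S by (simp add: field_simps)
qed

section \<open>The functions \<open>\<xi>\<^sub>k\<close>\<close>

definition orbit :: "int \<times> int \<Rightarrow> (int \<times> int) set" where
  "orbit k = {p. \<bar>fst p\<bar> = \<bar>fst k\<bar> \<and> \<bar>snd p\<bar> = \<bar>snd k\<bar>}"

lemma orbit_eq: "orbit (a, b) = {(a, b), (- a, - b), (a, - b), (- a, b)}"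
  by (auto simp: orbit_def abs_eq_iff)

text \<open>When a component is 0, the four sign changes list every orbit element equally often, so
  the mean is unaffected.\<close>

lemma orbit_average:
  fixes f :: "int \<times> int \<Rightarrow> real"
  shows "(\<Sum>p\<in>orbit (a, b). f p) / card (orbit (a, b))
    = (f (a, b) + f (- a, - b) + f (a, - b) + f (- a, b)) / 4"
  by (cases "a = 0"; cases "b = 0") (auto simp: orbit_eq sum.insert_if card_insert_if)

text \<open>In each coordinate the entries from one orbit add up to 0 or to plus or minus twice
  their common absolute value; different absolute values cannot compensate each other.\<close>

lemma orbit_sum_eq_0D:
  assumes k: "\<bar>fst k\<bar> \<noteq> \<bar>fst l\<bar>" "\<bar>snd k\<bar> \<noteq> \<bar>snd l\<bar>"
    and m: "p \<in> orbit k" "q \<in> orbit l" "r \<in> orbit k" "s \<in> orbit l" and sum: "p + q + r + s = 0"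
  shows "r = - p \<and> s = - q"
proof -
  have *: "c = - a \<and> d = - b" if "\<bar>a\<bar> = x" "\<bar>c\<bar> = x" "\<bar>b\<bar> = y" "\<bar>d\<bar> = y" "x \<noteq> y" "a + b + c + d = 0"
    for a b c d x y :: int
    using that by linarith
  have "fst p + fst q + fst r + fst s = 0" "snd p + snd q + snd r + snd s = 0"
    using arg_cong[OF sum, of fst] arg_cong[OF sum, of snd] by simp_all
  then show ?thesis
    using m k *[of "fst p" _ "fst r" "fst q" _ "fst s"] *[of "snd p" _ "snd r" "snd q" _ "snd s"]
    by (auto simp: orbit_def prod_eq_iff)
qed

abbreviation ivec :: "nat \<times> nat \<Rightarrow> int \<times> int" where
  "ivec k \<equiv> (int (fst k), int (snd k))"

text \<open>The four frequencies of \<open>\<xi>\<^sub>k\<close> coincide in pairs when a component of \<open>k\<close> vanishes, so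
  the coefficients have to be added up.\<close>
definition xi_coeff :: "complex \<Rightarrow> nat \<times> nat \<Rightarrow> int \<times> int \<Rightarrow> complex" where
  "xi_coeff a k p = (let s = (- 1) ^ (snd k + 1) in
     (if p = ivec k then a else 0) + (if p = - ivec k then cnj a else 0)
     + (if p = (int (fst k), - int (snd k)) then s * cnj a else 0)
     + (if p = (- int (fst k), int (snd k)) then s * a else 0))"

lemma xi_trep: "trep (xi a k) (orbit (ivec k)) (\<lambda>p. p) (xi_coeff a k)"
proof -
  let ?s = "(- 1) ^ (snd k + 1) :: complex"
  let ?k1 = "int (fst k)" and ?k2 = "int (snd k)"
  have fin: "finite (orbit (ivec k))" by (simp add: orbit_eq)
  have mem: "ivec k \<in> orbit (ivec k)" "- ivec k \<in> orbit (ivec k)"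
    "(?k1, - ?k2) \<in> orbit (ivec k)" "(- ?k1, ?k2) \<in> orbit (ivec k)"
    by (simp_all add: orbit_eq)
  have delta: "(\<Sum>p\<in>orbit (ivec k). (if p = q then c else 0) * ek p x) = c * ek q x"
    if "q \<in> orbit (ivec k)" for q c x
    using fin that by (simp add: if_distrib[of "\<lambda>z. z * _"] cong: if_cong)
  have sum: "tr (orbit (ivec k)) (\<lambda>p. p) (xi_coeff a k) x =
      a * ek (?k1, ?k2) x + cnj a * ek (- ?k1, - ?k2) x
         + ?s * cnj a * ek (?k1, - ?k2) x + ?s * a * ek (- ?k1, ?k2) x" for x
    unfolding tr_def xi_coeff_def Let_def distrib_right sum.distrib delta[OF mem(1)] delta[OF mem(2)]
      delta[OF mem(3)] delta[OF mem(4)] by simp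
  \<comment> \<open>Conjugation exchanges the terms in pairs, so the \<open>Re\<close> in
    \<open>xi\<close> discards nothing.\<close>
  have "cnj (tr (orbit (ivec k)) (\<lambda>p. p) (xi_coeff a k) x) = tr (orbit (ivec k)) (\<lambda>p. p) (xi_coeff a k) x" for x
    unfolding sum by (simp add: cnj_ek)
  then have "of_real (Re (tr (orbit (ivec k)) (\<lambda>p. p) (xi_coeff a k) x))
      = tr (orbit (ivec k)) (\<lambda>p. p) (xi_coeff a k) x" for x
    by (metis of_real_Re Reals_cnj_iff)
  moreover have "xi a k x = Re (tr (orbit (ivec k)) (\<lambda>p. p) (xi_coeff a k) x)" for x
    unfolding sum xi_def Let_def ..
  ultimately show ?thesis using fin by (simp add: trep_def)
qed

text \<open>I sends e_k to (-1)^{k2} e_{(-k1, k2)}, and the sign (-1)^{k2+1} in \<open>xi\<close> is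
  the negative of that factor; this gives oddness. The mean is 0 since the orbit misses frequency
  0.\<close>

lemma xi_lie_alg:
  assumes "k \<noteq> (0, 0)" shows "xi a k \<in> lie_alg"
proof -
  have "(\<Sum>p\<in>orbit (ivec k). if p = 0 then xi_coeff a k p else 0) = 0"
    using assms by (intro sum.neutral) (cases k, auto simp: orbit_def zero_prod_def)
  then have "integral torus_box (xi a k) = 0"
    using integral_trep[OF xi_trep[of a k]] by simp
  moreover have "xi a k (Iinv x) = - xi a k x" for x
  proof -
    have c: "cis (real n * pi) = (- 1) ^ n" for n :: nat
      using Complex.DeMoivre[of pi n] unfolding cis_pi by (rule sym)
    moreover have "cis (- (real n * pi)) = (- 1) ^ n" for n :: nat
      using arg_cong[OF c[of n], of cnj] by (simp add: cis_cnj)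
    ultimately show ?thesis
      by (cases "even (snd k)") (simp_all add: xi_def Let_def ek_Iinv)
  qed
  ultimately show ?thesis
    using trep_smooth2[OF xi_trep] trep_periodic2[OF xi_trep] by (simp add: lie_alg_iff)
qed

lemma xi_coeff_minus: "xi_coeff a k (- p) = cnj (xi_coeff a k p)"
  by (cases p) (auto simp: xi_coeff_def Let_def)

text \<open>Negation and k -> (k1, -k2) generate the orbit, and each changes the collected
  coefficient only by conjugation and a sign, even when frequencies coincide.\<close>

lemma norm_xi_coeff:
  assumes "p \<in> orbit (ivec k)"
  shows "norm (xi_coeff a k p) = norm (xi_coeff a k (ivec k))"
proof -
  let ?q = "(int (fst k), - int (snd k))"
  have "xi_coeff a k ?q = (- 1) ^ (snd k + 1) * cnj (xi_coeff a k (ivec k))"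
    by (cases "even (snd k)") (auto simp: xi_coeff_def Let_def)
  then have q: "norm (xi_coeff a k ?q) = norm (xi_coeff a k (ivec k))"
    by (simp add: norm_mult norm_power)
  have "p = ivec k \<or> p = - ivec k \<or> p = ?q \<or> p = - ?q"
    using assms by (auto simp: orbit_eq)
  then show ?thesis using q by (auto simp only: xi_coeff_minus complex_mod_cnj)
qed

text \<open>A nonzero \<open>a\<close> would not suffice: for k2 = 0 and k1 > 0 the coefficient at k
  is a - cnj a, and for k1 = 0 with k2 > 0 even it is 0.\<close>

lemma xi_coeff_nonzero:
  assumes "xi a k \<noteq> (\<lambda>x. 0)" shows "xi_coeff a k (ivec k) \<noteq> 0"
proof
  assume "xi_coeff a k (ivec k) = 0"
  then have "xi_coeff a k p = 0" if "p \<in> orbit (ivec k)" for p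
    using norm_xi_coeff[OF that, of a] by simp
  then have "complex_of_real (xi a k x) = 0" for x
    using trep_fun_eq[OF xi_trep, of a k] by (metis (no_types, lifting) tr_def mult_zero_left sum.neutral)
  then show False using assms by auto
qed

lemma xi_zero_freq: "xi a (0, 0) = (\<lambda>x. 0)"
  by (simp add: xi_def ek_def)

lemma sec_curv_xi:
  assumes k: "xi a k \<noteq> (\<lambda>x. 0)" and l: "xi b l \<noteq> (\<lambda>x. 0)"
    and kl: "fst l \<noteq> fst k" "snd l \<noteq> snd k"
  shows "sec_curv (xi a k) (xi b l) =
    - (\<Sum>p\<in>orbit (ivec k). \<Sum>q\<in>orbit (ivec l). of_int (cross p q) ^ 4 / of_int (nsq (q - p))) /
      (S_T * of_int (nsq (ivec k)) * of_int (nsq (ivec l)) * card (orbit (ivec k)) * card (orbit (ivec l)))"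
proof (rule sec_curv_trep)
  show "xi a k \<in> lie_alg" "xi b l \<in> lie_alg"
    using k l xi_zero_freq by (metis xi_lie_alg)+
  show "trep (xi a k) (orbit (ivec k)) (\<lambda>p. p) (xi_coeff a k)"
    "trep (xi b l) (orbit (ivec l)) (\<lambda>p. p) (xi_coeff b l)" by (rule xi_trep)+
  have prod: "xi_coeff a k p * xi_coeff a k (- p) = of_real ((norm (xi_coeff a k (ivec k)))\<^sup>2)"
    if "p \<in> orbit (ivec k)" for a k p
    using norm_xi_coeff[OF that, of a] by (simp add: xi_coeff_minus complex_norm_square[symmetric])
  show "xi_coeff a k p * xi_coeff a k (- p) = of_real ((norm (xi_coeff a k (ivec k)))\<^sup>2)"
    if "p \<in> orbit (ivec k)" for p using that by (rule prod)
  show "xi_coeff b l p * xi_coeff b l (- p) = of_real ((norm (xi_coeff b l (ivec l)))\<^sup>2)"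
    if "p \<in> orbit (ivec l)" for p using that by (rule prod)
  show "(norm (xi_coeff a k (ivec k)))\<^sup>2 \<noteq> 0" "(norm (xi_coeff b l (ivec l)))\<^sup>2 \<noteq> 0"
    using xi_coeff_nonzero k l by auto
  show "nsq p = nsq (ivec k)" if "p \<in> orbit (ivec k)" for p
    using that by (auto simp: orbit_eq nsq_def)
  show "nsq p = nsq (ivec l)" if "p \<in> orbit (ivec l)" for p
    using that by (auto simp: orbit_eq nsq_def)
  show "r = - p \<and> s = - q"
    if "p \<in> orbit (ivec k)" "q \<in> orbit (ivec l)" "r \<in> orbit (ivec k)" "s \<in> orbit (ivec l)" "p + q + r + s = 0"
    for p q r s
    by (rule orbit_sum_eq_0D[OF _ _ that]) (use kl in auto)
  show "p + q \<noteq> 0" if "p \<in> orbit (ivec k)" "q \<in> orbit (ivec l)" for p q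
  proof
    assume "p + q = 0"
    then have "fst p + fst q = 0" by (metis fst_add fst_zero)
    then show False using that kl by (auto simp: orbit_def)
  qed
qed (auto simp: orbit_def)

section \<open>The limit\<close>

lemma direction_limit_unit:
  fixes x y N :: "nat \<Rightarrow> real"
  assumes N: "filterlim N at_top sequentially" "\<And>m. (N m)\<^sup>2 = (x m)\<^sup>2 + (y m)\<^sup>2"
    and lim: "(\<lambda>m. x m / N m) \<longlonglongrightarrow> u" "(\<lambda>m. y m / N m) \<longlonglongrightarrow> v"
  shows "u\<^sup>2 + v\<^sup>2 = 1"
proof (rule LIMSEQ_unique)
  show "(\<lambda>m. (x m / N m)\<^sup>2 + (y m / N m)\<^sup>2) \<longlonglongrightarrow> u\<^sup>2 + v\<^sup>2"
    by (intro tendsto_intros lim)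
  have "eventually (\<lambda>m. N m > 0) sequentially"
    using N(1) by (simp add: filterlim_at_top_dense)
  then have "eventually (\<lambda>m. (x m / N m)\<^sup>2 + (y m / N m)\<^sup>2 = 1) sequentially"
    by eventually_elim (simp add: power_divide N(2)[symmetric] flip: add_divide_distrib)
  then show "(\<lambda>m. (x m / N m)\<^sup>2 + (y m / N m)\<^sup>2) \<longlonglongrightarrow> 1"
    by (rule tendsto_eventually)
qed

text \<open>Numerator and denominator are divided by |q|^4. Then |q - p|^2/|q|^2 tends to 1, since
  p/|q| tends to 0 and the limiting direction is a unit vector.\<close>

lemma quartic_limit:
  fixes q :: "nat \<Rightarrow> int \<times> int" and p :: "int \<times> int" and y1 y2 :: real
  defines "N \<equiv> \<lambda>m. sqrt (of_int (nsq (q m)))"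
  assumes N: "filterlim N at_top sequentially"
    and y: "(\<lambda>m. of_int (fst (q m)) / N m) \<longlonglongrightarrow> y1" "(\<lambda>m. of_int (snd (q m)) / N m) \<longlonglongrightarrow> y2"
  shows "(\<lambda>m. of_int (cross p (q m)) ^ 4 / of_int (nsq (q m - p)) / of_int (nsq (q m)))
    \<longlonglongrightarrow> (of_int (fst p) * y2 - of_int (snd p) * y1) ^ 4"
proof -
  have pos: "eventually (\<lambda>m. N m > 0) sequentially"
    using N by (simp add: filterlim_at_top_dense)
  have N2: "of_int (nsq (q m)) = (N m)\<^sup>2" for m by (simp add: N_def nsq_def)
  have "(N m)\<^sup>2 = (of_int (fst (q m)))\<^sup>2 + (of_int (snd (q m)))\<^sup>2" for m
    unfolding N2[symmetric] by (simp add: nsq_def)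
  then have one: "y1\<^sup>2 + y2\<^sup>2 = 1"
    by (rule direction_limit_unit[OF N _ y])
  have inv: "(\<lambda>m. c / N m) \<longlonglongrightarrow> 0" for c
    using tendsto_divide_0[OF tendsto_const filterlim_at_top_imp_at_infinity[OF N]] .
  let ?f = "\<lambda>m. (of_int (fst p) * (of_int (snd (q m)) / N m) - of_int (snd p) * (of_int (fst (q m)) / N m)) ^ 4
    / ((of_int (fst (q m)) / N m - of_int (fst p) / N m)\<^sup>2 + (of_int (snd (q m)) / N m - of_int (snd p) / N m)\<^sup>2)"
  have "?f \<longlonglongrightarrow> (of_int (fst p) * y2 - of_int (snd p) * y1) ^ 4 / ((y1 - 0)\<^sup>2 + (y2 - 0)\<^sup>2)"
    by (intro tendsto_intros y inv) (simp add: one)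
  then have "?f \<longlonglongrightarrow> (of_int (fst p) * y2 - of_int (snd p) * y1) ^ 4"
    by (simp add: one)
  moreover have "eventually (\<lambda>m. ?f m =
      of_int (cross p (q m)) ^ 4 / of_int (nsq (q m - p)) / of_int (nsq (q m))) sequentially"
    using pos
  proof eventually_elim
    case (elim m)
    have "of_int (fst p) * (of_int (snd (q m)) / N m) - of_int (snd p) * (of_int (fst (q m)) / N m)
        = of_int (cross p (q m)) / N m"
      by (simp add: cross_def diff_divide_distrib)
    moreover have "(of_int (fst (q m)) / N m - of_int (fst p) / N m)\<^sup>2
        + (of_int (snd (q m)) / N m - of_int (snd p) / N m)\<^sup>2 = of_int (nsq (q m - p)) / (N m)\<^sup>2"
      by (simp add: nsq_def power_divide add_divide_distrib flip: diff_divide_distrib)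
    \<comment> \<open>Division by zero makes both sides 0 if q = p.\<close>
    moreover have "(c / N m) ^ 4 / (d / (N m)\<^sup>2) = c ^ 4 / d / (N m)\<^sup>2" for c d
      using elim by (cases "d = 0") (simp_all add: field_simps flip: power_add)
    ultimately show ?case by (simp only: N2)
  qed
  ultimately show ?thesis by (rule Lim_transform_eventually)
qed

text \<open>On the closed first quadrant \<open>ang\<close> is the polar angle; its value pi/2 at x
  = 0 covers the vertical direction.\<close>

lemma cos_sin_ang:
  assumes "x \<ge> 0" "y \<ge> 0" "r > 0" "x\<^sup>2 + y\<^sup>2 = r\<^sup>2"
  shows "x = r * cos (ang x y)" "y = r * sin (ang x y)"
proof -
  have "x = r * cos (ang x y) \<and> y = r * sin (ang x y)"
  proof (cases "x = 0")
    case True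
    then have "y = r" using assms by (simp add: power2_eq_iff_nonneg)
    then show ?thesis using True by (simp add: ang_def)
  next
    case False
    then have x: "x > 0" using assms by simp
    have "1 + (y / x)\<^sup>2 = (r / x)\<^sup>2" using x assms(4) by (simp add: field_simps)
    then have "sqrt (1 + (y / x)\<^sup>2) = r / x" using x assms by simp
    then show ?thesis using x assms(3) by (simp add: ang_def cos_arctan sin_arctan)
  qed
  then show "x = r * cos (ang x y)" "y = r * sin (ang x y)" by auto
qed

theorem theorem4:
  fixes k :: "nat \<times> nat" and a :: complex
    and l :: "real \<times> real" and ls :: "nat \<Rightarrow> nat \<times> nat" and b :: "nat \<Rightarrow> complex"
  assumes "k \<noteq> (0, 0)"
    and "xi a k \<noteq> (\<lambda>x. 0)"
    and "\<forall>m. fst (ls m) \<noteq> fst k \<and> snd (ls m) \<noteq> snd k"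
    and "filterlim (\<lambda>m. sqrt (real (fst (ls m))^2 + real (snd (ls m))^2)) at_top sequentially"
    and "(\<lambda>m. (real (fst (ls m)) / sqrt (real (fst (ls m))^2 + real (snd (ls m))^2),
               real (snd (ls m)) / sqrt (real (fst (ls m))^2 + real (snd (ls m))^2)))
           \<longlonglongrightarrow> l"
    and "\<forall>m. xi (b m) (ls m) \<noteq> (\<lambda>x. 0)"
  shows "(\<lambda>m. sec_curv (xi a k) (xi (b m) (ls m))) \<longlonglongrightarrow>
     - ((real (fst k))^2 + (real (snd k))^2) / (2 * S_T)
       * (sin (ang (fst l) (snd l) - ang (real (fst k)) (real (snd k))) ^ 4
          + sin (ang (fst l) (snd l) + ang (real (fst k)) (real (snd k))) ^ 4)"
proof -
  define N where "N = (\<lambda>m. sqrt (real (fst (ls m))^2 + real (snd (ls m))^2))"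
  define K where "K = real_of_int (nsq (ivec k))"
  define \<kappa> where "\<kappa> = ang (real (fst k)) (real (snd k))"
  define \<theta> where "\<theta> = ang (fst l) (snd l)"
  define F :: "int \<times> int \<Rightarrow> int \<times> int \<Rightarrow> real" where
    "F = (\<lambda>p q. of_int (cross p q) ^ 4 / of_int (nsq (q - p)) / of_int (nsq q))"
  \<comment> \<open>The average over the sign changes of l_m, with p fixed.\<close>
  define G where "G = (\<lambda>m p. let x = int (fst (ls m)); y = int (snd (ls m)) in
    (F p (x, y) + F p (- x, - y) + F p (x, - y) + F p (- x, y)) / 4)"
  \<comment> \<open>The limit of \<open>G\<close>: fourth powers are even, so the four sign changes
    coincide in pairs and the average over four becomes one over two.\<close>
  define c where "c = (\<lambda>p :: int \<times> int. ((real_of_int (fst p) * snd l - of_int (snd p) * fst l) ^ 4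
    + (real_of_int (fst p) * snd l + of_int (snd p) * fst l) ^ 4) / 2)"
  have Kpos: "K > 0" unfolding K_def using assms(1)
    by (cases k) (auto simp: nsq_def sum_power2_gt_zero_iff simp flip: of_int_power of_int_add)
  have l1: "(\<lambda>m. real (fst (ls m)) / N m) \<longlonglongrightarrow> fst l" and l2: "(\<lambda>m. real (snd (ls m)) / N m) \<longlonglongrightarrow> snd l"
    using tendsto_fst[OF assms(5)] tendsto_snd[OF assms(5)] by (simp_all add: N_def)
  have N: "filterlim N at_top sequentially" using assms(4) by (simp add: N_def)

  have l_unit: "(fst l)\<^sup>2 + (snd l)\<^sup>2 = 1"
    by (rule direction_limit_unit[OF N _ l1 l2]) (simp add: N_def)
  have l_nonneg: "fst l \<ge> 0" "snd l \<ge> 0"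
    using LIMSEQ_le_const[OF l1, of 0] LIMSEQ_le_const[OF l2, of 0] by (auto simp: N_def)

  have lim: "(\<lambda>m. F p (s * int (fst (ls m)), t * int (snd (ls m))))
      \<longlonglongrightarrow> (of_int (fst p) * (of_int t * snd l) - of_int (snd p) * (of_int s * fst l)) ^ 4"
    if "s\<^sup>2 = 1" "t\<^sup>2 = 1" for p s t
  proof -
    have e: "sqrt (of_int (nsq (s * int (fst (ls m)), t * int (snd (ls m))))) = N m" for m
      by (simp add: nsq_def N_def power_mult_distrib that flip: of_int_power)
        (simp add: that)
    show ?thesis unfolding F_def
      by (rule quartic_limit)
        (use N tendsto_mult_left[OF l1, of "of_int s"] tendsto_mult_left[OF l2, of "of_int t"] in
          \<open>simp_all add: e\<close>)
  qed
  have G_lim: "(\<lambda>m. G m p) \<longlonglongrightarrow> c p" for p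
  proof -
    let ?x = "real_of_int (fst p)" and ?y = "real_of_int (snd p)"
    have "(\<lambda>m. G m p) \<longlonglongrightarrow> ((?x * snd l - ?y * fst l) ^ 4 + (?x * - snd l - ?y * - fst l) ^ 4
        + (?x * - snd l - ?y * fst l) ^ 4 + (?x * snd l - ?y * - fst l) ^ 4) / 4"
      (is "_ \<longlonglongrightarrow> ?E")
      unfolding G_def Let_def
      by (intro tendsto_intros)
        (use lim[of 1 1 p] lim[of "- 1" "- 1" p] lim[of 1 "- 1" p] lim[of "- 1" 1 p] in simp_all)
    also have "?E = c p"
    proof -
      have "(?x * - snd l - ?y * - fst l) ^ 4 = (?x * snd l - ?y * fst l) ^ 4"
        "(?x * - snd l - ?y * fst l) ^ 4 = (?x * snd l + ?y * fst l) ^ 4"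
        by (simp_all add: power4_eq_xxxx algebra_simps)
      then show ?thesis by (simp add: c_def)
    qed
    finally show ?thesis .
  qed

  let ?k1 = "int (fst k)" and ?k2 = "int (snd k)"
  have sec: "sec_curv (xi a k) (xi (b m) (ls m)) =
      - 1 / (S_T * K) * ((G m (?k1, ?k2) + G m (- ?k1, - ?k2) + G m (?k1, - ?k2) + G m (- ?k1, ?k2)) / 4)" for m
  proof -
    let ?L = "orbit (ivec (ls m))" and ?K = "orbit (ivec k)"
    have "sec_curv (xi a k) (xi (b m) (ls m)) = - 1 / (S_T * K) *
        ((\<Sum>p\<in>?K. (\<Sum>q\<in>?L. of_int (cross p q) ^ 4 / of_int (nsq (q - p)) / of_int (nsq (ivec (ls m)))) / card ?L) / card ?K)"
      using assms(3) sec_curv_xi[OF assms(2) assms(6)[rule_format, of m]]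
      unfolding sum_divide_distrib[symmetric] by (simp add: K_def mult_ac)
    also have "(\<Sum>p\<in>?K. (\<Sum>q\<in>?L. of_int (cross p q) ^ 4 / of_int (nsq (q - p)) / of_int (nsq (ivec (ls m)))) / card ?L)
        = (\<Sum>p\<in>?K. (\<Sum>q\<in>?L. F p q) / card ?L)"
      by (intro sum.cong refl arg_cong2[where f = "(/)"]) (auto simp: F_def orbit_eq nsq_def)
    also have "\<dots> = (\<Sum>p\<in>?K. G m p)"
      by (simp add: orbit_average G_def Let_def)
    finally show ?thesis by (simp only: orbit_average)
  qed
  have "(\<lambda>m. sec_curv (xi a k) (xi (b m) (ls m))) \<longlonglongrightarrow>
      - 1 / (S_T * K) * ((c (?k1, ?k2) + c (- ?k1, - ?k2) + c (?k1, - ?k2) + c (- ?k1, ?k2)) / 4)"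
    unfolding sec by (intro tendsto_intros G_lim) simp
  \<comment> \<open>Sign changes of k only permute the two fourth powers in \<open>c\<close>, so the
    second average is trivial.\<close>
  also have "(c (?k1, ?k2) + c (- ?k1, - ?k2) + c (?k1, - ?k2) + c (- ?k1, ?k2)) / 4 = c (?k1, ?k2)"
    by (simp add: c_def power4_eq_xxxx algebra_simps)
  also have "c (?k1, ?k2) = K\<^sup>2 * (sin (\<theta> - \<kappa>) ^ 4 + sin (\<theta> + \<kappa>) ^ 4) / 2"
  proof -
    have "real (fst k) = sqrt K * cos \<kappa>" "real (snd k) = sqrt K * sin \<kappa>"
      unfolding \<kappa>_def using Kpos by (auto intro!: cos_sin_ang simp: K_def nsq_def)
    moreover have "fst l = 1 * cos \<theta>" "snd l = 1 * sin \<theta>"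
      unfolding \<theta>_def by (rule cos_sin_ang; simp add: l_unit l_nonneg)+
    ultimately have "real (fst k) * snd l - real (snd k) * fst l = sqrt K * sin (\<theta> - \<kappa>)"
      "real (fst k) * snd l + real (snd k) * fst l = sqrt K * sin (\<theta> + \<kappa>)"
      by (simp_all add: sin_diff sin_add algebra_simps)
    moreover have "sqrt K ^ 4 = K\<^sup>2"
      using Kpos by (simp add: power4_eq_xxxx power2_eq_square)
    ultimately show ?thesis by (simp add: c_def power_mult_distrib distrib_left)
  qed
  \<comment> \<open>One of the two factors |k|^2 in |k|^4 cancels against the normalization, and the
    1/2 in \<open>c\<close> produces the 2 in the denominator.\<close>
  also have "- 1 / (S_T * K) * (K\<^sup>2 * (sin (\<theta> - \<kappa>) ^ 4 + sin (\<theta> + \<kappa>) ^ 4) / 2)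
      = - K / (2 * S_T) * (sin (\<theta> - \<kappa>) ^ 4 + sin (\<theta> + \<kappa>) ^ 4)"
    using Kpos by (simp add: S_T_def power2_eq_square divide_simps)
  also have "K = (real (fst k))^2 + (real (snd k))^2" by (simp add: K_def nsq_def)
  finally show ?thesis by (simp only: \<kappa>_def \<theta>_def)
qed

end
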